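(* For every normalized binary goods instance with an arbitrary number of agents, there exists a randomized allocation that is ex-ante EF, ex-ante EQ, and ex-post EQ1, and such a randomized allocation can be computed in polynomial time.
   Context: An instance consists of agents $N=\{1,\dots,n\}$, a finite set $M$ of indivisible items, and for each agent $i$ an additive valuation $v_i:2^M\to\mathbb{R}$, i.e. $v_i(\emptyset)=0$ and $v_i(S)=\sum_{o\in S}v_i(o)$. It is a binary goods instance if $v_i(o)\in\{0,1\}$ for all $i,o$. It is normalized if $v_i(M)=v_j(M)$ for all $i,j\in N$. An allocation $A=(A_1,\dots,A_n)$ is a partition of $M$ into $n$ pairwise disjoint, possibly empty bundles with union $M$. For goods, $A$ is EQ1 if for all $i,j\in N$ with $A_j\neq\emptyset$ there is $g\in A_j$ with $v_i(A_i)\ge v_j(A_j\setminus\{g\})$. A randomized allocation is a probability distribution over deterministic allocations $A^{(1)},\dots,A^{(k)}$ with probabilities $p_1,\dots,p_k\in[0,1]$, $\sum_\ell p_\ell=1$. It is ex-ante EQ if $\sum_\ell p_\ell v_i(A_i^{(\ell)})=\sum_\ell p_\ell v_j(A_j^{(\ell)})$ for all $i,j\in N$, and ex-ante EF if $\sum_\ell p_\ell v_i(A_i^{(\ell)})\ge\sum_\ell p_\ell v_i(A_j^{(\ell)})$ for all $i,j\in N$. It satisfies a property ex-post if every allocation in its support satisfies that property. Computing a randomized allocation means outputting the list of support allocations with their probabilities. *)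

theory Defs
  imports Complex_Main "HOL-Library.Disjoint_Sets" "HOL-Computational_Algebra.Polynomial"
begin

section \<open>Fair division\<close>

text \<open>The agents are \<open>{1..n}\<close>, and \<open>v i S\<close> is the value of the set \<open>S\<close> of items for agent \<open>i\<close>.\<close>

definition additive_instance :: "nat \<Rightarrow> 'a set \<Rightarrow> (nat \<Rightarrow> 'a set \<Rightarrow> real) \<Rightarrow> bool" where
  "additive_instance n M v \<longleftrightarrow>
     n \<ge> 1 \<and> finite M \<and>
     (\<forall>i\<in>{1..n}. v i {} = 0 \<and> (\<forall>S\<subseteq>M. v i S = (\<Sum>g\<in>S. v i {g})))"

definition binary_goods :: "nat \<Rightarrow> 'a set \<Rightarrow> (nat \<Rightarrow> 'a set \<Rightarrow> real) \<Rightarrow> bool" where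
  "binary_goods n M v \<longleftrightarrow> (\<forall>i\<in>{1..n}. \<forall>g\<in>M. v i {g} \<in> {0, 1})"

definition normalized :: "nat \<Rightarrow> 'a set \<Rightarrow> (nat \<Rightarrow> 'a set \<Rightarrow> real) \<Rightarrow> bool" where
  "normalized n M v \<longleftrightarrow> (\<forall>i\<in>{1..n}. \<forall>j\<in>{1..n}. v i M = v j M)"

definition normalized_binary_goods_instance ::
    "nat \<Rightarrow> 'a set \<Rightarrow> (nat \<Rightarrow> 'a set \<Rightarrow> real) \<Rightarrow> bool" where
  "normalized_binary_goods_instance n M v \<longleftrightarrow>
     additive_instance n M v \<and> binary_goods n M v \<and> normalized n M v"

text \<open>The last conjunct is a normal form: it makes two allocations equal as functions iff they
  give every agent the same bundle.\<close>

definition allocation :: "nat \<Rightarrow> 'a set \<Rightarrow> (nat \<Rightarrow> 'a set) \<Rightarrow> bool" where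
  "allocation n M A \<longleftrightarrow>
     disjoint_family_on A {1..n} \<and> (\<Union>i\<in>{1..n}. A i) = M \<and> (\<forall>i. i \<notin> {1..n} \<longrightarrow> A i = {})"

definition EQ1 :: "nat \<Rightarrow> (nat \<Rightarrow> 'a set \<Rightarrow> real) \<Rightarrow> (nat \<Rightarrow> 'a set) \<Rightarrow> bool" where
  "EQ1 n v A \<longleftrightarrow>
     (\<forall>i\<in>{1..n}. \<forall>j\<in>{1..n}. A j \<noteq> {} \<longrightarrow> (\<exists>g\<in>A j. v i (A i) \<ge> v j (A j - {g})))"

type_synonym 'a randomized = "(real \<times> (nat \<Rightarrow> 'a set)) list"

definition randomized_allocation :: "nat \<Rightarrow> 'a set \<Rightarrow> 'a randomized \<Rightarrow> bool" where
  "randomized_allocation n M R \<longleftrightarrow>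
     (\<forall>(p, A)\<in>set R. 0 \<le> p \<and> p \<le> 1 \<and> allocation n M A) \<and>
     distinct (map snd R) \<and> (\<Sum>(p, A)\<leftarrow>R. p) = 1"

definition ex_ante_EQ :: "nat \<Rightarrow> (nat \<Rightarrow> 'a set \<Rightarrow> real) \<Rightarrow> 'a randomized \<Rightarrow> bool" where
  "ex_ante_EQ n v R \<longleftrightarrow>
     (\<forall>i\<in>{1..n}. \<forall>j\<in>{1..n}. (\<Sum>(p, A)\<leftarrow>R. p * v i (A i)) = (\<Sum>(p, A)\<leftarrow>R. p * v j (A j)))"

definition ex_ante_EF :: "nat \<Rightarrow> (nat \<Rightarrow> 'a set \<Rightarrow> real) \<Rightarrow> 'a randomized \<Rightarrow> bool" where
  "ex_ante_EF n v R \<longleftrightarrow>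
     (\<forall>i\<in>{1..n}. \<forall>j\<in>{1..n}. (\<Sum>(p, A)\<leftarrow>R. p * v i (A i)) \<ge> (\<Sum>(p, A)\<leftarrow>R. p * v i (A j)))"

definition ex_post :: "((nat \<Rightarrow> 'a set) \<Rightarrow> bool) \<Rightarrow> 'a randomized \<Rightarrow> bool" where
  "ex_post Q R \<longleftrightarrow> (\<forall>(p, A)\<in>set R. p > 0 \<longrightarrow> Q A)"

definition EF_EQ_EQ1_randomized_allocation ::
    "nat \<Rightarrow> 'a set \<Rightarrow> (nat \<Rightarrow> 'a set \<Rightarrow> real) \<Rightarrow> 'a randomized \<Rightarrow> bool" where
  "EF_EQ_EQ1_randomized_allocation n M v R \<longleftrightarrow>
     randomized_allocation n M R \<and> ex_ante_EF n v R \<and> ex_ante_EQ n v R \<and> ex_post (EQ1 n v) R"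


section \<open>Machine model\<close>

text \<open>
  A random access machine, presented as a while language: finitely many registers and arrays of
  natural numbers (only those named in the program can matter), indirect addressing through
  array indices, and a write-only output tape. Every elementary step costs one time unit;
  expressions belong to the fixed program, so evaluating one takes a constant number of machine
  operations. The only arithmetic operations are addition and truncated subtraction, so numbers
  gain at most a constant number of bits per step. Unit cost without multiplication is therefore
  polynomially equivalent to Turing machine time.
\<close>

datatype exp =
    Const nat
  | Reg string
  | Arr string exp
  | Add exp exp
  | Sub exp exp

datatype cond =
    Less exp exp
  | Neg cond
  | Conj cond cond

datatype com =
    Skip
  | Assign string exp
  | Store string exp exp
  | Write exp
  | Seq com com
  | IfElse cond com com
  | While cond com

record state =
  regs :: "string \<Rightarrow> nat"
  arrs :: "string \<Rightarrow> nat \<Rightarrow> nat"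
  out :: "nat list"

fun eval_exp :: "exp \<Rightarrow> state \<Rightarrow> nat" where
  "eval_exp (Const k) s = k"
| "eval_exp (Reg x) s = regs s x"
| "eval_exp (Arr a e) s = arrs s a (eval_exp e s)"
| "eval_exp (Add e f) s = eval_exp e s + eval_exp f s"
| "eval_exp (Sub e f) s = eval_exp e s - eval_exp f s"

fun eval_cond :: "cond \<Rightarrow> state \<Rightarrow> bool" where
  "eval_cond (Less e f) s \<longleftrightarrow> eval_exp e s < eval_exp f s"
| "eval_cond (Neg b) s \<longleftrightarrow> \<not> eval_cond b s"
| "eval_cond (Conj b c) s \<longleftrightarrow> eval_cond b s \<and> eval_cond c s"

text \<open>\<open>runs c s t s'\<close>: started in \<open>s\<close>, the program \<open>c\<close> halts in \<open>s'\<close> after \<open>t\<close> steps.\<close>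

inductive runs :: "com \<Rightarrow> state \<Rightarrow> nat \<Rightarrow> state \<Rightarrow> bool" where
  Skip: "runs Skip s 1 s"
| Assign: "runs (Assign x e) s 1 (s\<lparr>regs := (regs s)(x := eval_exp e s)\<rparr>)"
| Store: "runs (Store a e f) s 1
     (s\<lparr>arrs := (arrs s)(a := (arrs s a)(eval_exp e s := eval_exp f s))\<rparr>)"
| Write: "runs (Write e) s 1 (s\<lparr>out := out s @ [eval_exp e s]\<rparr>)"
| Seq: "runs c s t s' \<Longrightarrow> runs d s' u s'' \<Longrightarrow> runs (Seq c d) s (t + u) s''"
| IfTrue: "eval_cond b s \<Longrightarrow> runs c s t s' \<Longrightarrow> runs (IfElse b c d) s (t + 1) s'"
| IfFalse: "\<not> eval_cond b s \<Longrightarrow> runs d s t s' \<Longrightarrow> runs (IfElse b c d) s (t + 1) s'"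
| WhileFalse: "\<not> eval_cond b s \<Longrightarrow> runs (While b c) s 1 s"
| WhileTrue: "eval_cond b s \<Longrightarrow> runs c s t s' \<Longrightarrow> runs (While b c) s' u s'' \<Longrightarrow>
     runs (While b c) s (t + u + 1) s''"

inductive_cases SkipE: "runs Skip s t s'"
inductive_cases AssignE: "runs (Assign x e) s t s'"
inductive_cases StoreE: "runs (Store a e f) s t s'"
inductive_cases WriteE: "runs (Write e) s t s'"
inductive_cases SeqE: "runs (Seq c d) s t s'"
inductive_cases IfElseE: "runs (IfElse b c d) s t s'"
inductive_cases WhileE: "runs (While b c) s t s'"

lemma runs_deterministic:
  "runs c s t s' \<Longrightarrow> runs c s u s'' \<Longrightarrow> t = u \<and> s' = s''"
proof (induction arbitrary: u s'' rule: runs.induct)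
  case Skip
  then show ?case by (rule SkipE) simp
next
  case Assign
  then show ?case by (rule AssignE) simp
next
  case Store
  then show ?case by (rule StoreE) simp
next
  case Write
  then show ?case by (rule WriteE) simp
next
  case Seq
  from Seq.prems show ?case by (rule SeqE) (use Seq.IH in metis)
next
  case IfTrue
  from IfTrue.prems show ?case by (rule IfElseE) (use IfTrue.IH IfTrue.hyps Suc_eq_plus1 in metis)+
next
  case IfFalse
  from IfFalse.prems show ?case by (rule IfElseE) (use IfFalse.IH IfFalse.hyps Suc_eq_plus1 in metis)+
next
  case WhileFalse
  from WhileFalse.prems show ?case by (rule WhileE) (use WhileFalse.hyps One_nat_def in metis)+
next
  case WhileTrue
  from WhileTrue.prems show ?case by (rule WhileE) (use WhileTrue.IH WhileTrue.hyps Suc_eq_plus1 in metis)+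
qed

lemma runs_output_length: "runs c s t s' \<Longrightarrow> length (out s') \<le> length (out s) + t"
  by (induction rule: runs.induct) auto


section \<open>Input and output\<close>

text \<open>An \<open>n \<times> m\<close> table, written row by row.\<close>

definition table :: "nat \<Rightarrow> nat \<Rightarrow> (nat \<Rightarrow> nat \<Rightarrow> bool) \<Rightarrow> nat list" where
  "table n m Q = concat (map (\<lambda>i. map (\<lambda>g. of_bool (Q i g)) [1..<m+1]) [1..<n+1])"

text \<open>For the computational statement the items are numbered \<open>1, ..., m\<close>. The input consists of
  \<open>n\<close>, \<open>m\<close> and the table of the binary values \<open>v i {g}\<close>.\<close>

definition input_state :: "nat \<Rightarrow> nat \<Rightarrow> (nat \<Rightarrow> nat set \<Rightarrow> real) \<Rightarrow> state" where
  "input_state n m v =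
     (let xs = table n m (\<lambda>i g. v i {g} = 1) in
      \<lparr>regs = (\<lambda>_. 0)(''n'' := n, ''m'' := m),
       arrs = (\<lambda>_ _. 0)(''v'' := (\<lambda>k. if k < length xs then xs ! k else 0)),
       out = []\<rparr>)"

text \<open>A list of triples \<open>(a, b, A)\<close> stands for the randomized allocation choosing \<open>A\<close> with
  probability \<open>a / b\<close>. Each triple is written as \<open>a\<close>, \<open>b\<close> and the table of the characteristic
  vectors of the bundles of \<open>A\<close>. All blocks have length \<open>n * m + 2\<close>, so no separators are needed.\<close>

definition encode_output :: "nat \<Rightarrow> nat \<Rightarrow> (nat \<times> nat \<times> (nat \<Rightarrow> nat set)) list \<Rightarrow> nat list" where
  "encode_output n m L = concat (map (\<lambda>(a, b, A). a # b # table n m (\<lambda>i g. g \<in> A i)) L)"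

definition to_randomized :: "(nat \<times> nat \<times> (nat \<Rightarrow> nat set)) list \<Rightarrow> nat randomized" where
  "to_randomized L = map (\<lambda>(a, b, A). (real a / real b, A)) L"

end

theory Submission imports Defs begin

text \<open>
  Give every item to every agent with probability \<open>1 / n\<close>; this fractional allocation is envy-free and
  equitable. It is implemented by \<open>n\<close> equally likely allocations such that each item goes to
  each agent in exactly one of them. If the numbers of liked items that an agent gets in two of
  these allocations always differ by at most one, then every single allocation is EQ1: if \<open>j\<close> had
  two more than \<open>i\<close> in one allocation, then \<open>j\<close> would have at least as much as \<open>i\<close> in all of them and
  more in total, against normalization.

  Such a family is found by local search. If agent \<open>i\<close> has at least two more liked items in
  allocation \<open>k\<close> than in \<open>l\<close>, exchange the two holders of one of the surplus items; this may create
  a new imbalance at the other holder, who continues in the same way with an unused item. When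
  this walk ends, the sum of the squares of all values has decreased, so polynomially many
  walks suffice.
\<close>

section \<open>Families of allocations\<close>

text \<open>Agents, items and allocations are counted from \<open>0\<close>, and \<open>B k g\<close> is the agent who gets item
  \<open>g\<close> in the \<open>k\<close>-th allocation. \<open>V i g\<close> says that agent \<open>i\<close> likes item \<open>g\<close>.\<close>

declare sum_of_bool_eq [simp del]

definition value_count :: "(nat \<Rightarrow> nat \<Rightarrow> bool) \<Rightarrow> nat set \<Rightarrow> (nat \<Rightarrow> nat \<Rightarrow> nat) \<Rightarrow> nat \<Rightarrow> nat \<Rightarrow> nat" where
  "value_count V S B k i = (\<Sum>g\<in>S. of_bool (B k g = i \<and> V i g))"

text \<open>Per item, the \<open>n\<close> allocations permute the agents: the discrete form of
  owning each item with probability \<open>1 / n\<close>.\<close>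

definition assignment_table :: "nat \<Rightarrow> nat \<Rightarrow> (nat \<Rightarrow> nat \<Rightarrow> nat) \<Rightarrow> bool" where
  "assignment_table n m B \<longleftrightarrow> (\<forall>g<m. bij_betw (\<lambda>k. B k g) {..<n} {..<n})"

definition balanced :: "nat \<Rightarrow> nat \<Rightarrow> (nat \<Rightarrow> nat \<Rightarrow> bool) \<Rightarrow> (nat \<Rightarrow> nat \<Rightarrow> nat) \<Rightarrow> bool" where
  "balanced n m V B \<longleftrightarrow>
     (\<forall>k<n. \<forall>l<n. \<forall>i<n. value_count V {..<m} B k i \<le> value_count V {..<m} B l i + 1)"

definition potential :: "nat \<Rightarrow> nat \<Rightarrow> (nat \<Rightarrow> nat \<Rightarrow> bool) \<Rightarrow> (nat \<Rightarrow> nat \<Rightarrow> nat) \<Rightarrow> nat" where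
  "potential n m V B = (\<Sum>(k, i)\<in>{..<n} \<times> {..<n}. (value_count V {..<m} B k i)\<^sup>2)"

definition flip :: "(nat \<Rightarrow> nat \<Rightarrow> nat) \<Rightarrow> nat \<Rightarrow> nat \<Rightarrow> nat \<Rightarrow> nat \<Rightarrow> nat \<Rightarrow> nat" where
  "flip B k l g = B(k := (B k)(g := B l g), l := (B l)(g := B k g))"

section \<open>Exchanges of holders and the sum of squares\<close>

lemma assignment_table_less:
  assumes "assignment_table n m B" "k < n" "g < m"
  shows "B k g < n"
  using assms by (force simp: assignment_table_def bij_betw_def)

lemma assignment_table_inj:
  assumes "assignment_table n m B" "k < n" "l < n" "g < m" "B k g = B l g"
  shows "k = l"
  using assms by (auto simp: assignment_table_def bij_betw_def inj_on_def)

lemma assignment_table_flip: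
  assumes "assignment_table n m B" "k < n" "l < n"
  shows "assignment_table n m (flip B k l g)"
  unfolding assignment_table_def
proof (intro allI impI)
  fix x assume "x < m"
  then have bij: "bij_betw (\<lambda>p. B p x) {..<n} {..<n}"
    using assms by (auto simp: assignment_table_def)
  show "bij_betw (\<lambda>p. flip B k l g p x) {..<n} {..<n}"
  proof (cases "x = g")
    case True
    let ?f = "\<lambda>p. flip B k l g p x"
    have sub: "?f ` {..<n} \<subseteq> {..<n}" and inj: "inj_on ?f {..<n}"
      using bij assms True by (force simp: flip_def bij_betw_def, auto simp: flip_def bij_betw_def inj_on_def)
    show ?thesis
      unfolding bij_betw_def using endo_inj_surj[OF _ sub inj] inj by simp
  next
    case False
    then have "(\<lambda>p. flip B k l g p x) = (\<lambda>p. B p x)"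
      by (auto simp: flip_def)
    then show ?thesis using bij by simp
  qed
qed

lemma value_count_le_card: "finite S \<Longrightarrow> value_count V S B k i \<le> card S"
  unfolding value_count_def by (rule order_trans[OF sum_mono[of S _ "\<lambda>_. 1"]]) auto

text \<open>Only the summand at \<open>g\<close> changes. Old and new contributions stand on
  opposite sides because subtraction on \<open>nat\<close> truncates.\<close>

lemma value_count_flip:
  assumes "finite S" "g \<in> S"
  shows "value_count V S (flip B k l g) p q + of_bool (B p g = q \<and> V q g)
       = value_count V S B p q + of_bool (flip B k l g p g = q \<and> V q g)"
proof -
  have "(\<Sum>x\<in>S - {g}. of_bool (flip B k l g p x = q \<and> V q x))
      = (\<Sum>x\<in>S - {g}. of_bool (B p x = q \<and> V q x) :: nat)"
    by (rule sum.cong) (auto simp: flip_def)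
  then show ?thesis
    using assms by (simp add: value_count_def sum.remove)
qed

text \<open>As \<open>g\<close> lies outside \<open>U\<close>, the counts over \<open>U\<close>
  survive the flip. This extends the set of used items along a walk.\<close>

lemma value_count_insert_flip:
  assumes "finite U" "g \<notin> U"
  shows "value_count V (insert g U) (flip B k l g) p q
       = value_count V U B p q + of_bool (flip B k l g p g = q \<and> V q g)"
proof -
  have "(\<Sum>x\<in>U. of_bool (flip B k l g p x = q \<and> V q x))
      = (\<Sum>x\<in>U. of_bool (B p x = q \<and> V q x) :: nat)"
    using assms by (intro sum.cong) (auto simp: flip_def)
  then show ?thesis
    using assms by (simp add: value_count_def)
qed

text \<open>There are \<open>n * n\<close> squares of counts of at most \<open>m\<close> items; this
  bounds the number of walks.\<close>

lemma potential_le: "potential n m V B \<le> n * n * (m * m)"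
proof -
  have "(case p of (k, i) \<Rightarrow> (value_count V {..<m} B k i)\<^sup>2) \<le> m * m" for p
    using value_count_le_card[of "{..<m}" V B] by (auto simp: power2_eq_square intro!: mult_mono split: prod.split)
  then have "potential n m V B \<le> (\<Sum>p\<in>{..<n} \<times> {..<n}. m * m)"
    unfolding potential_def by (intro sum_mono)
  then show ?thesis by simp
qed

text \<open>Only four squares change. Let \<open>d\<close> be the surplus of agent
  \<open>B k g\<close> in \<open>k\<close> over \<open>l\<close> before the flip and
  \<open>d'\<close> that of agent \<open>B l g\<close> after it. The first agent changes the
  potential by \<open>2 - 2d\<close>, the second by \<open>2d' - 2\<close> when liking
  \<open>g\<close> and by 0 otherwise.\<close>

lemma potential_flip:
  assumes B: "assignment_table n m B" and kl: "k < n" "l < n" "k \<noteq> l" and g: "g < m"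
    and V: "V (B k g) g"
  defines "B' \<equiv> flip B k l g"
  shows "V (B l g) g \<Longrightarrow>
           potential n m V B' + 2 * value_count V {..<m} B k (B k g) + 2 * value_count V {..<m} B' l (B l g)
         = potential n m V B + 2 * value_count V {..<m} B l (B k g) + 2 * value_count V {..<m} B' k (B l g)"
    and "\<not> V (B l g) g \<Longrightarrow>
           potential n m V B' + 2 * value_count V {..<m} B k (B k g)
         = potential n m V B + 2 * value_count V {..<m} B l (B k g) + 2"
proof -
  define i where "i = B k g"
  define j where "j = B l g"
  let ?c = "value_count V {..<m} B" and ?c' = "value_count V {..<m} B'"
  have ij: "i < n" "j < n" "i \<noteq> j"
    using assignment_table_less[OF B] assignment_table_inj[OF B, of k l g] kl g
    unfolding i_def j_def by auto
  have c: "?c' p q + of_bool (B p g = q \<and> V q g) = ?c p q + of_bool (B' p g = q \<and> V q g)" for p q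
    unfolding B'_def using g by (intro value_count_flip) auto
  have B': "B' k g = j" "B' l g = i" "\<And>p. p \<noteq> k \<Longrightarrow> p \<noteq> l \<Longrightarrow> B' p g = B p g"
    using kl by (auto simp: B'_def flip_def i_def j_def)
  let ?A = "{..<n} \<times> {..<n}" and ?S = "{k, l} \<times> {i, j}"
  have same: "?c' p q = ?c p q" if "(p, q) \<notin> ?S" for p q
    using c[of p q] B' that by (cases "p = k"; cases "p = l") (auto simp: i_def j_def)
  have S: "?S \<subseteq> ?A" "finite ?A"
    using kl ij by auto
  \<comment> \<open>Stated for arbitrary \<open>d\<close>, to split the four affected squares off
    both the old and the new sum.\<close>
  have pot: "(\<Sum>(p, q)\<in>?A. (d p q)\<^sup>2) = (\<Sum>(p, q)\<in>?A - ?S. (d p q)\<^sup>2)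
      + ((d k i)\<^sup>2 + (d k j)\<^sup>2 + (d l i)\<^sup>2 + (d l j)\<^sup>2)" for d :: "nat \<Rightarrow> nat \<Rightarrow> nat"
    using sum.subset_diff[OF S, of "\<lambda>(p, q). (d p q)\<^sup>2"] kl ij
    by (simp add: Sigma_def insert_commute)
  have rest: "(\<Sum>(p, q)\<in>?A - ?S. (?c' p q)\<^sup>2) = (\<Sum>(p, q)\<in>?A - ?S. (?c p q)\<^sup>2)"
  proof (intro sum.cong refl)
    fix x assume "x \<in> ?A - ?S"
    then show "(case x of (p, q) \<Rightarrow> (?c' p q)\<^sup>2) = (case x of (p, q) \<Rightarrow> (?c p q)\<^sup>2)"
      using same[of "fst x" "snd x"] by (simp add: split_beta)
  qed
  have eq: "potential n m V B' + ((?c k i)\<^sup>2 + (?c k j)\<^sup>2 + (?c l i)\<^sup>2 + (?c l j)\<^sup>2)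
     = potential n m V B + ((?c' k i)\<^sup>2 + (?c' k j)\<^sup>2 + (?c' l i)\<^sup>2 + (?c' l j)\<^sup>2)"
    unfolding potential_def pot[of ?c] pot[of ?c'] rest by simp
  have ki: "?c k i = ?c' k i + 1" and li: "?c' l i = ?c l i + 1"
    using c[of k i] c[of l i] B' ij V by (auto simp: i_def j_def)
  show "potential n m V B' + 2 * ?c k (B k g) + 2 * ?c' l (B l g)
      = potential n m V B + 2 * ?c l (B k g) + 2 * ?c' k (B l g)" if "V (B l g) g"
  proof -
    have "?c' k j = ?c k j + 1" "?c l j = ?c' l j + 1"
      using c[of k j] c[of l j] B' ij that by (auto simp: i_def j_def)
    with eq ki li show ?thesis
      by (simp add: power2_eq_square flip: i_def j_def)
  qed
  show "potential n m V B' + 2 * ?c k (B k g) = potential n m V B + 2 * ?c l (B k g) + 2"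
    if "\<not> V (B l g) g"
  proof -
    have "?c' k j = ?c k j" "?c' l j = ?c l j"
      using c[of k j] c[of l j] B' ij that by (auto simp: i_def j_def)
    with eq ki li show ?thesis
      by (simp add: power2_eq_square flip: i_def j_def)
  qed
qed

text \<open>The items in \<open>U\<close> account for at most one of a surplus of at least two, so
  some of it lies outside \<open>U\<close>.\<close>

lemma unused_item_exists:
  assumes U: "U \<subseteq> {..<m}" and "value_count V {..<m} B l j + 2 \<le> value_count V {..<m} B k j"
    and "value_count V U B k j \<le> value_count V U B l j + 1"
  shows "\<exists>g<m. g \<notin> U \<and> B k g = j \<and> V j g"
proof (rule ccontr)
  assume none: "\<not> ?thesis"
  have split: "value_count V {..<m} B p j = value_count V ({..<m} - U) B p j + value_count V U B p j" for p
    unfolding value_count_def by (rule sum.subset_diff[OF U]) simp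
  have "value_count V ({..<m} - U) B k j = 0"
    unfolding value_count_def using none by (intro sum.neutral) auto
  with assms split[of k] split[of l] show False by linarith
qed

section \<open>From tables to randomized allocations\<close>

text \<open>Agent \<open>i\<close> is agent \<open>i - 1\<close> of the table, and \<open>e\<close>
  names the items. The empty default gives the normal form of \<open>allocation\<close>; without it,
  agent \<open>0\<close> would share the bundle of agent \<open>1\<close>, as
  \<open>0 - 1 = 0\<close>.\<close>

definition bundles :: "nat \<Rightarrow> nat \<Rightarrow> (nat \<Rightarrow> 'a) \<Rightarrow> (nat \<Rightarrow> nat \<Rightarrow> nat) \<Rightarrow> nat \<Rightarrow> nat \<Rightarrow> 'a set" where
  "bundles n m e B k i = (if i \<in> {1..n} then e ` {g. g < m \<and> B k g = i - 1} else {})"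

lemma EF_EQ_EQ1_bundles:
  assumes inst: "normalized_binary_goods_instance n M v" and e: "bij_betw e {..<m} M"
    and m: "0 < m" and B: "assignment_table n m B"
    and V: "\<And>i g. i < n \<Longrightarrow> g < m \<Longrightarrow> V i g \<longleftrightarrow> v (Suc i) {e g} = 1"
    and bal: "balanced n m V B"
  shows "EF_EQ_EQ1_randomized_allocation n M v (map (\<lambda>k. (1 / real n, bundles n m e B k)) [0..<n])"
proof -
  let ?R = "map (\<lambda>k. (1 / real n, bundles n m e B k)) [0..<n]"
  have n: "0 < n" and finM: "finite M"
    using inst by (auto simp: normalized_binary_goods_instance_def additive_instance_def)
  have add: "v i S = (\<Sum>g\<in>S. v i {g})" if "i \<in> {1..n}" "S \<subseteq> M" for i S
    using inst that unfolding normalized_binary_goods_instance_def additive_instance_def by blast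
  have bin: "v i {g} \<in> {0, 1}" if "i \<in> {1..n}" "g \<in> M" for i g
    using inst that unfolding normalized_binary_goods_instance_def binary_goods_def by blast
  have norm: "v i M = v j M" if "i \<in> {1..n}" "j \<in> {1..n}" for i j
    using inst that unfolding normalized_binary_goods_instance_def normalized_def by blast
  have e_inj: "inj_on e {..<m}" and e_im: "e ` {..<m} = M"
    using e by (auto simp: bij_betw_def)
  have eM: "e g \<in> M" if "g < m" for g
    using e_im that by auto
  have less_i: "i - 1 < n" if "i \<in> {1..n}" for i
    using that by auto
  have single: "v i {e g} = of_bool (V (i - 1) g)" if "i \<in> {1..n}" "g < m" for i g
    using V[OF less_i[OF that(1)] that(2)] bin[OF that(1) eM[OF that(2)]] that by auto
  have val: "v i (e ` S) = (\<Sum>g\<in>S. of_bool (V (i - 1) g))" if "i \<in> {1..n}" "S \<subseteq> {..<m}" for i S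
  proof -
    have "v i (e ` S) = (\<Sum>g\<in>e ` S. v i {g})"
      using that e_im by (intro add) auto
    also have "\<dots> = (\<Sum>g\<in>S. v i {e g})"
      using inj_on_subset[OF e_inj that(2)] by (simp add: sum.reindex)
    also have "\<dots> = (\<Sum>g\<in>S. of_bool (V (i - 1) g))"
      using that by (intro sum.cong single) auto
    finally show ?thesis .
  qed
  have val_bundle: "v i (bundles n m e B k j) = (\<Sum>g<m. of_bool (B k g = j - 1 \<and> V (i - 1) g))"
    if "i \<in> {1..n}" "j \<in> {1..n}" for i j k
  proof -
    have "v i (bundles n m e B k j) = (\<Sum>g | g < m \<and> B k g = j - 1. of_bool (V (i - 1) g))"
      using that val[of i "{g. g < m \<and> B k g = j - 1}"] by (auto simp: bundles_def)
    also have "\<dots> = (\<Sum>g<m. of_bool (B k g = j - 1 \<and> V (i - 1) g))"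
      by (rule sum.mono_neutral_cong_left) auto
    finally show ?thesis .
  qed
  have val_count: "v i (bundles n m e B k i) = real (value_count V {..<m} B k (i - 1))"
    if "i \<in> {1..n}" for i k
    using val_bundle[OF that that] by (simp add: value_count_def)
  \<comment> \<open>Column \<open>g\<close> is a permutation of the agents, so the sum can be
    reindexed along it.\<close>
  have once: "(\<Sum>k<n. of_bool (B k g = j)) = (1 :: real)" if "g < m" "j < n" for g j
  proof -
    have "(\<Sum>k<n. of_bool (B k g = j)) = (\<Sum>p<n. of_bool (p = j) :: real)"
      using B that sum.reindex_bij_betw[of "\<lambda>k. B k g" "{..<n}" "{..<n}" "\<lambda>p. of_bool (p = j)"]
      by (auto simp: assignment_table_def)
    then show ?thesis using that by (simp add: of_bool_def)
  qed
  have total: "(\<Sum>k<n. v i (bundles n m e B k j)) = v i M" if "i \<in> {1..n}" "j \<in> {1..n}" for i j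
  proof -
    have "(\<Sum>k<n. v i (bundles n m e B k j))
        = (\<Sum>g<m. \<Sum>k<n. of_bool (B k g = j - 1 \<and> V (i - 1) g))"
      unfolding val_bundle[OF that] by (rule sum.swap)
    also have "\<dots> = (\<Sum>g<m. of_bool (V (i - 1) g) * (\<Sum>k<n. of_bool (B k g = j - 1)))"
      by (simp add: sum_distrib_left of_bool_conj mult.commute)
    also have "\<dots> = (\<Sum>g<m. of_bool (V (i - 1) g))"
      using that by (intro sum.cong) (auto simp: once)
    also have "\<dots> = v i M"
      using val[OF that(1), of "{..<m}"] e_im by simp
    finally show ?thesis .
  qed
  \<comment> \<open>For fixed \<open>i\<close> the expectation does not depend on \<open>j\<close>,
    so EF holds with equality; normalization adds EQ.\<close>
  have ante: "(\<Sum>(p, A)\<leftarrow>?R. p * v i (A j)) = v i M / real n"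
    if "i \<in> {1..n}" "j \<in> {1..n}" for i j
    using total[OF that]
    by (simp add: comp_def interv_sum_list_conv_sum_set_nat atLeast0LessThan flip: sum_divide_distrib)
  have alloc: "allocation n M (bundles n m e B k)" if "k < n" for k
    unfolding allocation_def
  proof (intro conjI)
    show "disjoint_family_on (bundles n m e B k) {1..n}"
      unfolding disjoint_family_on_def
    proof (intro ballI impI equals0I)
      fix i j y assume ij: "i \<in> {1..n}" "j \<in> {1..n}" "i \<noteq> j"
        and "y \<in> bundles n m e B k i \<inter> bundles n m e B k j"
      then obtain g h where "g < m" "h < m" "B k g = i - 1" "B k h = j - 1" "e g = e h"
        by (auto simp: bundles_def)
      moreover from this have "g = h"
        using inj_onD[OF e_inj] by simp
      ultimately show False using ij by auto
    qed
    show "(\<Union>i\<in>{1..n}. bundles n m e B k i) = M"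
    proof (intro equalityI subsetI)
      fix y assume "y \<in> M"
      then obtain g where g: "g < m" "y = e g" using e_im by auto
      with assignment_table_less[OF B that] have "y \<in> bundles n m e B k (Suc (B k g))"
        and "Suc (B k g) \<in> {1..n}"
        by (auto simp: bundles_def Suc_le_eq)
      then show "y \<in> (\<Union>i\<in>{1..n}. bundles n m e B k i)" by blast
    qed (use eM in \<open>auto simp: bundles_def split: if_splits\<close>)
  qed (auto simp: bundles_def)
  \<comment> \<open>The support must be distinct: item \<open>0\<close>, available by
    \<open>0 < m\<close>, has a different holder in each allocation.\<close>
  have "inj_on (bundles n m e B) {..<n}"
  proof (rule inj_onI)
    fix k l assume kl: "k \<in> {..<n}" "l \<in> {..<n}" "bundles n m e B k = bundles n m e B l"
    have "e 0 \<in> bundles n m e B k (Suc (B k 0))"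
      using assignment_table_less[OF B, of k 0] kl(1) m by (auto simp: bundles_def)
    then have "e 0 \<in> bundles n m e B l (Suc (B k 0))"
      using kl by simp
    then have "B l 0 = B k 0"
      using e_inj m by (auto simp: bundles_def inj_on_def split: if_splits)
    then show "k = l"
      using assignment_table_inj[OF B, of l k 0] kl m by auto
  qed
  then have "randomized_allocation n M ?R"
    using n alloc by (auto simp: randomized_allocation_def comp_def distinct_map atLeast0LessThan
        sum_list_triv)
  moreover have "ex_ante_EF n v ?R"
    unfolding ex_ante_EF_def using ante by simp
  moreover have "ex_ante_EQ n v ?R"
    unfolding ex_ante_EQ_def using ante norm by metis
  moreover have "EQ1 n v (bundles n m e B k)" if "k < n" for k
    unfolding EQ1_def
  proof (intro ballI impI)
    fix i j assume ij: "i \<in> {1..n}" "j \<in> {1..n}" and ne: "bundles n m e B k j \<noteq> {}"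
    let ?c = "\<lambda>k i. value_count V {..<m} B k (i - 1)"
    have sums: "(\<Sum>l<n. ?c l i) = (\<Sum>l<n. ?c l j)"
    proof -
      have "real (\<Sum>l<n. ?c l i) = real (\<Sum>l<n. ?c l j)"
        using total[OF ij(1) ij(1)] total[OF ij(2) ij(2)] norm[OF ij] val_count[OF ij(1)]
          val_count[OF ij(2)] by simp
      then show ?thesis by linarith
    qed
    have le: "?c k j \<le> ?c k i + 1"
    proof (rule ccontr)
      assume gt: "\<not> ?thesis"
      \<comment> \<open>The chain is
        \<open>?c l i \<le> ?c k i + 1 \<le> ?c k j - 1 \<le> ?c l j\<close>, and the inequality is
        strict at \<open>l = k\<close>.\<close>
      have "?c l i \<le> ?c l j" if "l < n" for l
      proof -
        have "?c l i \<le> ?c k i + 1" "?c k j \<le> ?c l j + 1"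
          using bal ij \<open>k < n\<close> \<open>l < n\<close> by (auto simp: balanced_def)
        with gt show ?thesis by linarith
      qed
      then have "(\<Sum>l<n. ?c l i) < (\<Sum>l<n. ?c l j)"
        using \<open>k < n\<close> gt by (intro sum_strict_mono_ex1) (auto intro!: bexI[of _ k])
      with sums show False by simp
    qed
    have rem: "v j (bundles n m e B k j - {x}) = real (?c k j) - v j {x}"
      if "x \<in> bundles n m e B k j" for x
    proof -
      have sub: "bundles n m e B k j \<subseteq> M"
        using eM by (auto simp: bundles_def split: if_splits)
      then show ?thesis
        using that finite_subset[OF sub finM] add[OF ij(2), of "bundles n m e B k j"]
          add[OF ij(2), of "bundles n m e B k j - {x}"] val_count[OF ij(2)]
        by (auto simp: sum_diff1)
    qed
    show "\<exists>g\<in>bundles n m e B k j. v j (bundles n m e B k j - {g}) \<le> v i (bundles n m e B k i)"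
    \<comment> \<open>If \<open>j\<close> likes nothing in the bundle, any item may be removed,
      values being nonnegative; otherwise a liked one is.\<close>
    proof (cases "?c k j = 0")
      case True
      from ne obtain x where x: "x \<in> bundles n m e B k j" by auto
      then have "x \<in> M" using eM by (auto simp: bundles_def split: if_splits)
      with bin[OF ij(2)] have "0 \<le> v j {x}" by force
      with x True rem[OF x] val_count[OF ij(1)] show ?thesis
        by (intro bexI[of _ x]) auto
    next
      case False
      then obtain g where g: "g < m" "B k g = j - 1" "V (j - 1) g"
        by (auto simp: value_count_def)
      then have x: "e g \<in> bundles n m e B k j" and "v j {e g} = 1"
        using ij single by (auto simp: bundles_def)
      with rem[OF x] val_count[OF ij(1)] le show ?thesis
        by (intro bexI[of _ "e g"]) auto
    qed
  qed
  ultimately show ?thesis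
    by (auto simp: EF_EQ_EQ1_randomized_allocation_def ex_post_def)
qed

text \<open>Without items all \<open>n\<close> allocations would coincide and could not be listed
  separately, so a single certain one replaces them.\<close>

lemma EF_EQ_EQ1_no_items:
  assumes "normalized_binary_goods_instance n {} v"
  shows "EF_EQ_EQ1_randomized_allocation n {} v [(1, \<lambda>_. {})]"
proof -
  have "v i {} = 0" if "i \<in> {1..n}" for i
    using assms that unfolding normalized_binary_goods_instance_def additive_instance_def by blast
  then show ?thesis
    by (auto simp: EF_EQ_EQ1_randomized_allocation_def randomized_allocation_def allocation_def
        ex_ante_EF_def ex_ante_EQ_def ex_post_def EQ1_def disjoint_family_on_def)
qed

section \<open>Timed execution\<close>

text \<open>Total correctness with a time budget, for one start state. Since \<open>T\<close> is
  only an upper bound, budgets can be added and weakened.\<close>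

definition ok :: "com \<Rightarrow> nat \<Rightarrow> state \<Rightarrow> (state \<Rightarrow> bool) \<Rightarrow> bool" where
  "ok c T s Q \<longleftrightarrow> (\<exists>t s'. runs c s t s' \<and> t \<le> T \<and> Q s')"

lemma ok_mono: "ok c T s Q \<Longrightarrow> T \<le> T' \<Longrightarrow> (\<And>s'. Q s' \<Longrightarrow> Q' s') \<Longrightarrow> ok c T' s Q'"
  unfolding ok_def by (meson order_trans)

lemma ok_Seq:
  assumes "ok c T s (\<lambda>s'. ok d U s' Q)"
  shows "ok (Seq c d) (T + U) s Q"
proof -
  obtain t s' where t: "runs c s t s'" "t \<le> T" "ok d U s' Q"
    using assms by (auto simp: ok_def)
  then obtain u s'' where "runs d s' u s''" "u \<le> U" "Q s''"
    by (auto simp: ok_def)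
  with t show ?thesis
    unfolding ok_def by (meson runs.Seq add_mono)
qed

lemma ok_IfElse:
  assumes "eval_cond b s \<Longrightarrow> ok c T s Q" "\<not> eval_cond b s \<Longrightarrow> ok d T s Q"
  shows "ok (IfElse b c d) (T + 1) s Q"
proof (cases "eval_cond b s")
  case True
  with assms show ?thesis
    unfolding ok_def by (metis IfTrue add_le_mono1)
next
  case False
  with assms show ?thesis
    unfolding ok_def by (metis IfFalse add_le_mono1)
qed

text \<open>The first argument of the invariant is a bound on the number of remaining iterations.\<close>

lemma ok_While:
  assumes step: "\<And>\<mu> s. Inv \<mu> s \<Longrightarrow> eval_cond b s \<Longrightarrow> ok c T s (\<lambda>s'. \<exists>\<mu>'<\<mu>. Inv \<mu>' s')"
    and "Inv \<mu> s"
  shows "ok (While b c) (\<mu> * (T + 1) + 1) s (\<lambda>s'. \<not> eval_cond b s' \<and> (\<exists>\<mu>'. Inv \<mu>' s'))"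
  using assms(2)
proof (induction \<mu> arbitrary: s rule: less_induct)
  case (less \<mu>)
  show ?case
  proof (cases "eval_cond b s")
    case True
    obtain t s' \<mu>' where t: "runs c s t s'" "t \<le> T" "\<mu>' < \<mu>" "Inv \<mu>' s'"
      using step[OF less.prems True] by (auto simp: ok_def)
    obtain u s'' where u: "runs (While b c) s' u s''" "u \<le> \<mu>' * (T + 1) + 1"
      "\<not> eval_cond b s'' \<and> (\<exists>\<mu>'. Inv \<mu>' s'')"
      using less.IH[OF t(3,4)] by (auto simp: ok_def)
    have "Suc \<mu>' * (T + 1) \<le> \<mu> * (T + 1)"
      using t by (intro mult_right_mono) auto
    then have "t + u + 1 \<le> \<mu> * (T + 1) + 1"
      using t u by simp
    with WhileTrue[OF True t(1) u(1)] u(3) show ?thesis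
      unfolding ok_def by blast
  next
    case False
    then have "runs (While b c) s 1 s" by (rule WhileFalse)
    with False less.prems show ?thesis
      unfolding ok_def by (metis le_add2)
  qed
qed

definition For :: "string \<Rightarrow> exp \<Rightarrow> com \<Rightarrow> com" where
  "For x e c = Seq (Assign x (Const 0))
     (While (Less (Reg x) e) (Seq c (Assign x (Add (Reg x) (Const 1)))))"

definition set_reg :: "string \<Rightarrow> nat \<Rightarrow> state \<Rightarrow> state" where
  "set_reg x k s = s\<lparr>regs := (regs s)(x := k)\<rparr>"

lemma set_reg_simps [simp]:
  "regs (set_reg x k s) y = (if y = x then k else regs s y)"
  "arrs (set_reg x k s) = arrs s"
  "out (set_reg x k s) = out s"
  by (simp_all add: set_reg_def)

definition set_arr :: "string \<Rightarrow> nat \<Rightarrow> nat \<Rightarrow> state \<Rightarrow> state" where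
  "set_arr a i k s = s\<lparr>arrs := (arrs s)(a := (arrs s a)(i := k))\<rparr>"

lemma set_arr_simps [simp]:
  "regs (set_arr a i k s) = regs s"
  "arrs (set_arr a i k s) b j = (if b = a \<and> j = i then k else arrs s b j)"
  "out (set_arr a i k s) = out s"
  by (simp_all add: set_arr_def)

definition write_out :: "nat \<Rightarrow> state \<Rightarrow> state" where
  "write_out k s = s\<lparr>out := out s @ [k]\<rparr>"

lemma write_out_simps [simp]:
  "regs (write_out k s) = regs s"
  "arrs (write_out k s) = arrs s"
  "out (write_out k s) = out s @ [k]"
  by (simp_all add: write_out_def)

text \<open>Loop-free programs are executed symbolically; on loops \<open>exec\<close> is a dummy.\<close>

fun loop_free :: "com \<Rightarrow> bool" where
  "loop_free (Seq c d) \<longleftrightarrow> loop_free c \<and> loop_free d"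
| "loop_free (IfElse b c d) \<longleftrightarrow> loop_free c \<and> loop_free d"
| "loop_free (While b c) \<longleftrightarrow> False"
| "loop_free _ \<longleftrightarrow> True"

fun exec :: "com \<Rightarrow> state \<Rightarrow> state" where
  "exec (Assign x e) s = set_reg x (eval_exp e s) s"
| "exec (Store a e f) s = set_arr a (eval_exp e s) (eval_exp f s) s"
| "exec (Write e) s = write_out (eval_exp e s) s"
| "exec (Seq c d) s = exec d (exec c s)"
| "exec (IfElse b c d) s = (if eval_cond b s then exec c s else exec d s)"
| "exec _ s = s"

fun cost :: "com \<Rightarrow> nat" where
  "cost (Seq c d) = cost c + cost d"
| "cost (IfElse b c d) = cost c + cost d + 1"
| "cost _ = 1"

lemma loop_free_runs: "loop_free c \<Longrightarrow> \<exists>t\<le>cost c. runs c s t (exec c s)"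
proof (induction c arbitrary: s)
  case (Seq c d)
  then obtain t u where "t \<le> cost c" "runs c s t (exec c s)" "u \<le> cost d"
    "runs d (exec c s) u (exec d (exec c s))"
    by (metis loop_free.simps(1))
  then show ?case
    by (auto intro!: exI[of _ "t + u"] intro: runs.Seq)
next
  case (IfElse b c d)
  then obtain t u where "t \<le> cost c" "runs c s t (exec c s)" "u \<le> cost d" "runs d s u (exec d s)"
    by (metis loop_free.simps(2))
  then show ?case
    using IfTrue[of b s c t "exec c s" d] IfFalse[of b s d u "exec d s" c]
    by (cases "eval_cond b s") (auto intro: exI[of _ "t + 1"] exI[of _ "u + 1"])
qed (auto simp: set_reg_def set_arr_def write_out_def
    intro!: exI[of _ "Suc 0"] runs.intros[unfolded One_nat_def])

lemma ok_loop_free: "loop_free c \<Longrightarrow> cost c \<le> T \<Longrightarrow> Q (exec c s) \<Longrightarrow> ok c T s Q"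
  unfolding ok_def using loop_free_runs[of c s] by (meson order_trans)

text \<open>The measure for \<open>ok_While\<close> is \<open>N - i\<close>. \<open>Inv\<close> is
  demanded after the increment because it may mention \<open>x\<close>. A round pays for the body,
  the increment and the test; the final 2 is the initial assignment and the failing test.\<close>

lemma ok_For:
  assumes step: "\<And>i s. i < N \<Longrightarrow> Inv i s \<Longrightarrow> regs s x = i \<Longrightarrow>
      ok c T s (\<lambda>s'. regs s' x = i \<and> Inv (Suc i) (set_reg x (Suc i) s'))"
    and bound: "\<And>i s. Inv i s \<Longrightarrow> eval_exp e s = N"
    and init: "Inv 0 (set_reg x 0 s)"
  shows "ok (For x e c) (N * (T + 2) + 2) s (Inv N)"
proof -
  let ?J = "\<lambda>\<mu> s. \<mu> \<le> N \<and> regs s x = N - \<mu> \<and> Inv (N - \<mu>) s"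
  let ?c = "Seq c (Assign x (Add (Reg x) (Const 1)))"
  have body: "ok ?c (T + 1) s (\<lambda>s'. \<exists>\<mu>'<\<mu>. ?J \<mu>' s')"
    if J: "?J \<mu> s" and b: "eval_cond (Less (Reg x) e) s" for \<mu> s
  proof -
    have lt: "N - \<mu> < N"
      using J b bound by auto
    then have suc: "Suc (N - \<mu>) = N - (\<mu> - 1)"
      using J by auto
    have "ok c T s (\<lambda>s'. regs s' x = N - \<mu> \<and> Inv (Suc (N - \<mu>)) (set_reg x (Suc (N - \<mu>)) s'))"
      using step lt J by blast
    then show ?thesis
      by (rule ok_Seq[OF ok_mono])
        (use J lt in \<open>auto simp: suc intro!: ok_loop_free exI[of _ "\<mu> - 1"]\<close>)
  qed
  have "ok (While (Less (Reg x) e) ?c) (N * (T + 1 + 1) + 1) (set_reg x 0 s)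
      (\<lambda>s'. \<not> eval_cond (Less (Reg x) e) s' \<and> (\<exists>\<mu>'. ?J \<mu>' s'))"
    by (rule ok_While[OF body]) (use init in auto)
  then have "ok (For x e c) (1 + (N * (T + 1 + 1) + 1)) s
      (\<lambda>s'. \<not> eval_cond (Less (Reg x) e) s' \<and> (\<exists>\<mu>'. ?J \<mu>' s'))"
    unfolding For_def by (intro ok_Seq[OF ok_loop_free]) simp_all
  then show ?thesis
  proof (rule ok_mono)
    fix s' assume "\<not> eval_cond (Less (Reg x) e) s' \<and> (\<exists>\<mu>'. ?J \<mu>' s')"
    then obtain \<mu>' where "?J \<mu>' s'" "\<not> N - \<mu>' < N"
      using bound by auto
    then have "N - \<mu>' = N" by linarith
    with \<open>?J \<mu>' s'\<close> show "Inv N s'" by simp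
  qed simp
qed

section \<open>The program\<close>

definition Equal :: "exp \<Rightarrow> exp \<Rightarrow> cond" where
  "Equal e f = Conj (Neg (Less e f)) (Neg (Less f e))"

text \<open>The machine cannot multiply, so row offsets are looked up in \<open>r\<close>.\<close>

definition Cell :: "string \<Rightarrow> exp \<Rightarrow> exp \<Rightarrow> exp" where
  "Cell a e f = Arr a (Add (Arr ''r'' e) f)"

lemma eval_Equal [simp]: "eval_cond (Equal e f) s \<longleftrightarrow> eval_exp e s = eval_exp f s"
  by (auto simp: Equal_def)

lemma eval_Cell [simp]:
  "eval_exp (Cell a e f) s = arrs s a (arrs s ''r'' (eval_exp e s) + eval_exp f s)"
  by (simp add: Cell_def)

text \<open>
  Row \<open>p\<close> of a two-dimensional array starts at index \<open>r[p] = p * m\<close>. Registers: \<open>(k, l, i)\<close> is the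
  triple under inspection, \<open>j\<close> the agent the walk has reached, \<open>x\<close> and \<open>y\<close> the values of
  \<open>j\<close> in the allocations \<open>k\<close> and \<open>l\<close>, and \<open>h\<close> an unused liked item of \<open>j\<close> in \<open>k\<close>. An
  item is used if its entry in \<open>Z\<close> is the number \<open>c\<close> of the current walk, so that no
  array has to be cleared.
\<close>

definition scan_item :: com where
  "scan_item =
     IfElse (Less (Const 0) (Cell ''v'' (Reg ''j'') (Reg ''g'')))
       (Seq
         (IfElse (Equal (Cell ''B'' (Reg ''k'') (Reg ''g'')) (Reg ''j''))
           (Seq (Assign ''x'' (Add (Reg ''x'') (Const 1)))
             (IfElse (Equal (Arr ''Z'' (Reg ''g'')) (Reg ''c'')) Skip (Assign ''h'' (Reg ''g''))))
           Skip)
         (IfElse (Equal (Cell ''B'' (Reg ''l'') (Reg ''g'')) (Reg ''j''))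
           (Assign ''y'' (Add (Reg ''y'') (Const 1)))
           Skip))
       Skip"

definition scan :: com where
  "scan = Seq (Seq (Assign ''x'' (Const 0)) (Assign ''y'' (Const 0))) (For ''g'' (Reg ''m'') scan_item)"

text \<open>If the other holder does not like the item, resetting \<open>x\<close> and
  \<open>y\<close> falsifies \<open>unbalanced\<close> and ends the walk.\<close>

definition walk_step :: com where
  "walk_step =
     Seq (Seq (Assign ''o'' (Cell ''B'' (Reg ''l'') (Reg ''h'')))
         (Seq (Store ''B'' (Add (Arr ''r'' (Reg ''l'')) (Reg ''h'')) (Reg ''j''))
         (Seq (Store ''B'' (Add (Arr ''r'' (Reg ''k'')) (Reg ''h'')) (Reg ''o''))
              (Store ''Z'' (Reg ''h'') (Reg ''c'')))))
       (IfElse (Less (Const 0) (Cell ''v'' (Reg ''o'') (Reg ''h'')))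
         (Seq (Assign ''j'' (Reg ''o'')) scan)
         (Seq (Assign ''x'' (Const 0)) (Assign ''y'' (Const 0))))"

definition unbalanced :: cond where
  "unbalanced = Less (Add (Reg ''y'') (Const 1)) (Reg ''x'')"

definition restart :: com where
  "restart = Seq (Assign ''k'' (Const 0)) (Seq (Assign ''l'' (Const 0)) (Assign ''i'' (Const 0)))"

text \<open>An odometer with \<open>i\<close> fastest; \<open>k\<close> reaches \<open>n\<close>
  once all triples have passed.\<close>

definition advance :: com where
  "advance = Seq (Assign ''i'' (Add (Reg ''i'') (Const 1)))
     (IfElse (Less (Reg ''i'') (Reg ''n'')) Skip
       (Seq (Assign ''i'' (Const 0))
       (Seq (Assign ''l'' (Add (Reg ''l'') (Const 1)))
         (IfElse (Less (Reg ''l'') (Reg ''n'')) Skip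
           (Seq (Assign ''l'' (Const 0)) (Assign ''k'' (Add (Reg ''k'') (Const 1))))))))"

definition balance_round :: com where
  "balance_round =
     Seq (Seq (Assign ''j'' (Reg ''i'')) (Assign ''c'' (Add (Reg ''c'') (Const 1))))
       (Seq scan (IfElse unbalanced (Seq (While unbalanced walk_step) restart) advance))"

definition balance :: com where
  "balance = Seq restart (While (Less (Reg ''k'') (Reg ''n'')) balance_round)"

definition fill_row :: com where
  "fill_row = Seq (Store ''B'' (Reg ''a'') (Reg ''k'')) (Assign ''a'' (Add (Reg ''a'') (Const 1)))"

text \<open>Initially allocation \<open>k\<close> gives everything to agent \<open>k\<close>. The
  running index \<open>a\<close> yields the row offsets by addition alone.\<close>

definition fill :: com where
  "fill = Seq (Assign ''a'' (Const 0))
     (For ''k'' (Reg ''n'')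
       (Seq (Store ''r'' (Reg ''k'') (Reg ''a'')) (For ''g'' (Reg ''m'') fill_row)))"

text \<open>The two truncated differences add up to the distance between holder and
  \<open>i\<close>, so the bit is 1 exactly when they agree.\<close>

definition write_cell :: com where
  "write_cell =
     Write (Sub (Const 1)
       (Add (Sub (Cell ''B'' (Reg ''k'') (Reg ''g'')) (Reg ''i''))
            (Sub (Reg ''i'') (Cell ''B'' (Reg ''k'') (Reg ''g'')))))"

definition write_table :: com where
  "write_table = For ''k'' (Reg ''n'')
     (Seq (Seq (Write (Const 1)) (Write (Reg ''n'')))
       (For ''i'' (Reg ''n'') (For ''g'' (Reg ''m'') write_cell)))"

text \<open>For \<open>m = 0\<close> tables are empty, and \<open>1, 1\<close> encodes the empty
  allocation with probability 1.\<close>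

definition program :: com where
  "program =
     IfElse (Less (Const 0) (Reg ''m''))
       (Seq fill (Seq balance write_table))
       (Seq (Write (Const 1)) (Write (Const 1)))"

section \<open>Correctness and step counts of the local search\<close>

context
  fixes n m :: nat and V :: "nat \<Rightarrow> nat \<Rightarrow> bool"
begin

definition ready :: "state \<Rightarrow> bool" where
  "ready s \<longleftrightarrow> regs s ''n'' = n \<and> regs s ''m'' = m \<and> out s = [] \<and>
     (\<forall>i<n. \<forall>g<m. arrs s ''v'' (i * m + g) = of_bool (V i g)) \<and>
     (\<forall>k<n. arrs s ''r'' k = k * m)"

definition stores :: "state \<Rightarrow> (nat \<Rightarrow> nat \<Rightarrow> nat) \<Rightarrow> bool" where
  "stores s B \<longleftrightarrow> (\<forall>k<n. \<forall>g<m. arrs s ''B'' (k * m + g) = B k g)"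

definition unchanged :: "string set \<Rightarrow> state \<Rightarrow> state \<Rightarrow> bool" where
  "unchanged X s s' \<longleftrightarrow> (\<forall>y. y \<notin> X \<longrightarrow> regs s' y = regs s y) \<and> arrs s' = arrs s \<and> out s' = out s"

text \<open>Division with remainder by \<open>m\<close> recovers row and column, so a store affects
  only one cell of the table.\<close>

lemma cell_eq_iff:
  assumes "g < m" "h < m"
  shows "k * m + g = l * m + h \<longleftrightarrow> k = l \<and> g = h"
proof
  assume "k * m + g = l * m + h"
  then have "(k * m + g) div m = (l * m + h) div m" "(k * m + g) mod m = (l * m + h) mod m"
    by simp_all
  with assms show "k = l \<and> g = h" by simp
qed auto

text \<open>The loop invariant is the same claim for the items below \<open>N\<close>. Nothing is
  claimed about \<open>h\<close> if no candidate exists, as it then keeps a stale value.\<close>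

lemma ok_scan:
  assumes s: "ready s" "stores s B"
    and k: "regs s ''k'' = k" "k < n" and l: "regs s ''l'' = l" "l < n"
    and j: "regs s ''j'' = j" "j < n"
  shows "ok scan (m * 13 + 4) s (\<lambda>s'. unchanged {''g'', ''x'', ''y'', ''h''} s s' \<and>
    regs s' ''x'' = value_count V {..<m} B k j \<and> regs s' ''y'' = value_count V {..<m} B l j \<and>
    ((\<exists>g<m. arrs s ''Z'' g \<noteq> regs s ''c'' \<and> B k g = j \<and> V j g) \<longrightarrow>
       regs s' ''h'' < m \<and> arrs s ''Z'' (regs s' ''h'') \<noteq> regs s ''c'' \<and>
       B k (regs s' ''h'') = j \<and> V j (regs s' ''h'')))"
proof -
  define Inv where "Inv N s' \<longleftrightarrow> unchanged {''g'', ''x'', ''y'', ''h''} s s' \<and>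
    regs s' ''x'' = value_count V {..<N} B k j \<and> regs s' ''y'' = value_count V {..<N} B l j \<and>
    ((\<exists>g<N. arrs s ''Z'' g \<noteq> regs s ''c'' \<and> B k g = j \<and> V j g) \<longrightarrow>
       regs s' ''h'' < N \<and> arrs s ''Z'' (regs s' ''h'') \<noteq> regs s ''c'' \<and>
       B k (regs s' ''h'') = j \<and> V j (regs s' ''h''))" for N s'
  let ?s = "exec (Seq (Assign ''x'' (Const 0)) (Assign ''y'' (Const 0))) s"
  have "ok (For ''g'' (Reg ''m'') scan_item) (m * (11 + 2) + 2) ?s (Inv m)"
  proof (rule ok_For[where Inv = "Inv"])
    fix g s' assume g: "g < m" and inv: "Inv g s'" and gg: "regs s' ''g'' = g"
    have r: "regs s' ''k'' = k" "regs s' ''l'' = l" "regs s' ''j'' = j" "regs s' ''c'' = regs s ''c''"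
      and a: "arrs s' = arrs s"
      using inv k l j by (auto simp: Inv_def unchanged_def)
    have cells: "arrs s ''v'' (j * m + g) = of_bool (V j g)" "arrs s ''B'' (k * m + g) = B k g"
      "arrs s ''B'' (l * m + g) = B l g" "arrs s ''r'' k = k * m" "arrs s ''r'' l = l * m"
      "arrs s ''r'' j = j * m"
      using s k l j g by (auto simp: ready_def stores_def)
    have "regs (exec scan_item s') z =
        (if z = ''x'' then regs s' z + of_bool (B k g = j \<and> V j g)
         else if z = ''y'' then regs s' z + of_bool (B l g = j \<and> V j g)
         else if z = ''h'' \<and> B k g = j \<and> V j g \<and> arrs s ''Z'' g \<noteq> regs s ''c'' then g
         else regs s' z)"
      and "arrs (exec scan_item s') = arrs s'" "out (exec scan_item s') = out s'" for z
      by (cases "V j g"; cases "B k g = j"; cases "B l g = j"; cases "arrs s ''Z'' g = regs s ''c''";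
          simp add: scan_item_def r a cells gg)+
    then have "regs (exec scan_item s') ''g'' = g \<and> Inv (Suc g) (set_reg ''g'' (Suc g) (exec scan_item s'))"
      using inv gg by (auto simp: Inv_def unchanged_def a value_count_def less_Suc_eq)
    moreover have "loop_free scan_item" "cost scan_item \<le> 11"
      by (simp_all add: scan_item_def)
    ultimately show "ok scan_item 11 s' (\<lambda>s'. regs s' ''g'' = g \<and> Inv (Suc g) (set_reg ''g'' (Suc g) s'))"
      by (intro ok_loop_free)
  next
    fix g s' assume "Inv g s'"
    then show "eval_exp (Reg ''m'') s' = m"
      using s by (auto simp: Inv_def unchanged_def ready_def)
  qed (auto simp: Inv_def unchanged_def value_count_def)
  then have "ok scan (2 + (m * (11 + 2) + 2)) s (Inv m)"
    unfolding scan_def by (intro ok_Seq[OF ok_loop_free]) simp_all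
  then show ?thesis
    by (rule ok_mono) (auto simp: Inv_def)
qed

lemma ready_unchanged:
  assumes "ready s" "unchanged X s s'" "''n'' \<notin> X" "''m'' \<notin> X"
  shows "ready s'"
  using assms by (auto simp: ready_def unchanged_def)

definition used :: "state \<Rightarrow> nat set" where
  "used s = {g. g < m \<and> arrs s ''Z'' g = regs s ''c''}"

text \<open>The walk leaves the unbalanced agent \<open>i\<close> along an item whose holders in the allocations
  \<open>k\<close> and \<open>l\<close> are exchanged. Among the items used so far, every agent other than the two ends
  \<open>i\<close> and \<open>j\<close> of the walk gets equally many in \<open>k\<close> as in \<open>l\<close>, so an unbalanced \<open>j\<close> still
  has an unused item to continue with. The potential minus twice the imbalance of \<open>j\<close> is
  constant along the walk.\<close>

definition walk_inv :: "nat \<Rightarrow> nat \<Rightarrow> nat \<Rightarrow> nat \<Rightarrow> nat \<Rightarrow> nat \<Rightarrow> state \<Rightarrow> bool" where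
  "walk_inv P c k l i \<mu> s \<longleftrightarrow>
     ready s \<and> regs s ''c'' = c \<and> regs s ''k'' = k \<and> regs s ''l'' = l \<and> k < n \<and> l < n \<and> k \<noteq> l \<and>
     (\<forall>g<m. arrs s ''Z'' g \<le> c) \<and> \<mu> + card (used s) = m \<and>
     (\<exists>B. stores s B \<and> assignment_table n m B \<and>
       (if eval_cond unbalanced s then
          potential n m V B + 4 + 2 * regs s ''y'' \<le> P + 2 * regs s ''x'' \<and> regs s ''j'' < n \<and>
          regs s ''x'' = value_count V {..<m} B k (regs s ''j'') \<and>
          regs s ''y'' = value_count V {..<m} B l (regs s ''j'') \<and>
          regs s ''h'' < m \<and> regs s ''h'' \<notin> used s \<and>
          B k (regs s ''h'') = regs s ''j'' \<and> V (regs s ''j'') (regs s ''h'') \<and>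
          (\<forall>q. value_count V (used s) B k q + of_bool (q = i) =
               value_count V (used s) B l q + of_bool (q = regs s ''j''))
        else potential n m V B < P))"

lemma ok_walk_step:
  assumes inv: "walk_inv P c k l i \<mu> s" and unb: "eval_cond unbalanced s"
  shows "ok walk_step (m * 13 + 10) s (\<lambda>s'. \<exists>\<mu>'<\<mu>. walk_inv P c k l i \<mu>' s')"
proof -
  define j h where "j = regs s ''j''" and "h = regs s ''h''"
  from inv unb obtain B where B: "stores s B" "assignment_table n m B"
    and pot: "potential n m V B + 4 + 2 * value_count V {..<m} B l j \<le> P + 2 * value_count V {..<m} B k j"
    and j: "j < n" and h: "h < m" "h \<notin> used s" "B k h = j" "V j h"
    and trail: "\<And>q. value_count V (used s) B k q + of_bool (q = i) =
               value_count V (used s) B l q + of_bool (q = j)"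
    by (auto simp: walk_inv_def j_def h_def)
  have s: "ready s" "regs s ''c'' = c" "regs s ''k'' = k" "regs s ''l'' = l" "k < n" "l < n" "k \<noteq> l"
    "\<forall>g<m. arrs s ''Z'' g \<le> c" "\<mu> + card (used s) = m"
    using inv by (auto simp: walk_inv_def)
  define o' where "o' = B l h"
  define B' where "B' = flip B k l h"
  have o': "o' < n"
    using assignment_table_less[OF B(2)] s h by (simp add: o'_def)
  have cells: "arrs s ''r'' k = k * m" "arrs s ''r'' l = l * m" "arrs s ''B'' (l * m + h) = o'"
    using s(1,5,6) B(1) h(1) by (auto simp: ready_def stores_def o'_def)
  define s1 where "s1 = exec (Seq (Assign ''o'' (Cell ''B'' (Reg ''l'') (Reg ''h'')))
         (Seq (Store ''B'' (Add (Arr ''r'' (Reg ''l'')) (Reg ''h'')) (Reg ''j''))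
         (Seq (Store ''B'' (Add (Arr ''r'' (Reg ''k'')) (Reg ''h'')) (Reg ''o''))
              (Store ''Z'' (Reg ''h'') (Reg ''c''))))) s"
  have s1: "s1 = set_arr ''Z'' h c (set_arr ''B'' (k * m + h) o'
      (set_arr ''B'' (l * m + h) j (set_reg ''o'' o' s)))"
    using s cells by (simp add: s1_def j_def h_def)
  have B': "stores s1 B'" "assignment_table n m B'"
    using B(1) h cell_eq_iff assignment_table_flip[OF B(2)] s
    by (auto simp: s1 stores_def B'_def flip_def o'_def)
  have ready1: "ready s1"
    using s(1) by (simp add: s1 ready_def)
  have used1: "used s1 = insert h (used s)"
    using h(1) s(2) by (auto simp: used_def s1)
  have fin: "finite (used s)" "used s1 \<subseteq> {..<m}"
    using h(1) by (auto simp: used_def used1)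
  have card1: "card (used s1) = card (used s) + 1"
    using fin h(2) by (simp add: used1)
  moreover have "card (used s1) \<le> m"
    using card_mono[OF _ fin(2)] by simp
  ultimately have mu: "\<mu> - 1 < \<mu>" "\<mu> - 1 + card (used s1) = m"
    using s(9) by auto
  have stamps: "\<forall>g<m. arrs s1 ''Z'' g \<le> c"
    using s(8) by (simp add: s1)
  have regs1: "regs s1 ''c'' = c" "regs s1 ''k'' = k" "regs s1 ''l'' = l" "regs s1 ''h'' = h"
    "regs s1 ''o'' = o'"
    using s by (simp_all add: s1 h_def)
  have cell1: "eval_cond (Less (Const 0) (Cell ''v'' (Reg ''o'') (Reg ''h''))) s1 \<longleftrightarrow> V o' h"
    using ready1 o' h(1) by (auto simp: regs1 ready_def)
  have "ok (IfElse (Less (Const 0) (Cell ''v'' (Reg ''o'') (Reg ''h'')))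
         (Seq (Assign ''j'' (Reg ''o'')) scan)
         (Seq (Assign ''x'' (Const 0)) (Assign ''y'' (Const 0)))) ((1 + (m * 13 + 4)) + 1) s1
       (\<lambda>s'. \<exists>\<mu>'<\<mu>. walk_inv P c k l i \<mu>' s')"
  proof (rule ok_IfElse)
    assume "eval_cond (Less (Const 0) (Cell ''v'' (Reg ''o'') (Reg ''h''))) s1"
    then have Vo: "V o' h" using cell1 by simp
    define s2 where "s2 = set_reg ''j'' o' s1"
    have s2: "ready s2" "stores s2 B'" "regs s2 ''k'' = k" "regs s2 ''l'' = l" "regs s2 ''j'' = o'"
      "regs s2 ''c'' = c" "arrs s2 = arrs s1"
      using ready1 B' by (auto simp: s2_def regs1 ready_def stores_def)
    have pot': "potential n m V B' + 4 + 2 * value_count V {..<m} B' l o'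
        \<le> P + 2 * value_count V {..<m} B' k o'"
      using potential_flip(1)[OF B(2) s(5,6,7) h(1), of V] Vo h pot
      by (simp add: o'_def B'_def)
    \<comment> \<open>The exchange adds \<open>h\<close> for \<open>o'\<close> in \<open>k\<close>
      and for \<open>j\<close> in \<open>l\<close>, which moves the end of the trail from
      \<open>j\<close> to \<open>o'\<close>.\<close>
    have trail': "value_count V (used s1) B' k q + of_bool (q = i) =
               value_count V (used s1) B' l q + of_bool (q = o')" for q
      using trail[of q] value_count_insert_flip[OF fin(1) h(2), of V B k l k q]
        value_count_insert_flip[OF fin(1) h(2), of V B k l l q] Vo h s(7)
      by (auto simp: used1 B'_def flip_def o'_def split: if_splits)
    have "ok scan (m * 13 + 4) s2 (\<lambda>s'. \<exists>\<mu>'<\<mu>. walk_inv P c k l i \<mu>' s')"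
    proof (rule ok_mono[OF ok_scan[OF s2(1,2,3) s(5) s2(4) s(6) s2(5) o'] order_refl], elim conjE)
      fix s' assume un: "unchanged {''g'', ''x'', ''y'', ''h''} s2 s'"
        and x: "regs s' ''x'' = value_count V {..<m} B' k o'"
        and y: "regs s' ''y'' = value_count V {..<m} B' l o'"
        and next_item: "(\<exists>g<m. arrs s2 ''Z'' g \<noteq> regs s2 ''c'' \<and> B' k g = o' \<and> V o' g) \<longrightarrow>
          regs s' ''h'' < m \<and> arrs s2 ''Z'' (regs s' ''h'') \<noteq> regs s2 ''c'' \<and>
          B' k (regs s' ''h'') = o' \<and> V o' (regs s' ''h'')"
      have r: "regs s' ''k'' = k" "regs s' ''l'' = l" "regs s' ''j'' = o'" "regs s' ''c'' = c"
        "arrs s' = arrs s1"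
        using un s2 by (auto simp: unchanged_def)
      have used': "used s' = used s1"
        using r regs1 by (simp add: used_def)
      have "regs s' ''h'' < m \<and> regs s' ''h'' \<notin> used s' \<and> B' k (regs s' ''h'') = o' \<and> V o' (regs s' ''h'')"
        if "eval_cond unbalanced s'"
      proof -
        \<comment> \<open>By \<open>trail'\<close>, the used items give \<open>o'\<close> at most
          one more in \<open>k\<close> than in \<open>l\<close>.\<close>
        have "\<exists>g<m. g \<notin> used s1 \<and> B' k g = o' \<and> V o' g"
          using that x y trail'[of o'] by (intro unused_item_exists[OF fin(2), where l = l]) (auto simp: unbalanced_def)
        then have "\<exists>g<m. arrs s2 ''Z'' g \<noteq> regs s2 ''c'' \<and> B' k g = o' \<and> V o' g"
          using s2 regs1 by (auto simp: used_def)
        with next_item show ?thesis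
          using s2 r by (auto simp: used_def)
      qed
      moreover have "ready s'"
        using ready_unchanged[OF s2(1) un] by simp
      moreover have "stores s' B'"
        using s2 r by (simp add: stores_def)
      moreover have "potential n m V B' < P" if "\<not> eval_cond unbalanced s'"
        using that pot' x y by (auto simp: unbalanced_def)
      ultimately have "walk_inv P c k l i (\<mu> - 1) s'"
        unfolding walk_inv_def r used' using B'(2) s(5,6,7) stamps mu(2) pot' x y o' trail'
        by (intro conjI exI[of _ B'], simp_all only: if_split refl simp_thms) simp
      with mu(1) show "\<exists>\<mu>'<\<mu>. walk_inv P c k l i \<mu>' s'" by blast
    qed
    then show "ok (Seq (Assign ''j'' (Reg ''o'')) scan) (1 + (m * 13 + 4)) s1
       (\<lambda>s'. \<exists>\<mu>'<\<mu>. walk_inv P c k l i \<mu>' s')"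
      by (intro ok_Seq[OF ok_loop_free]) (simp_all add: s2_def regs1)
  next
    assume "\<not> eval_cond (Less (Const 0) (Cell ''v'' (Reg ''o'') (Reg ''h''))) s1"
    then have Vo: "\<not> V o' h" using cell1 by simp
    have pot': "potential n m V B' < P"
      using potential_flip(2)[OF B(2) s(5,6,7) h(1), of V] Vo h pot
      by (simp add: o'_def B'_def)
    let ?s = "set_reg ''y'' 0 (set_reg ''x'' 0 s1)"
    have "ready ?s" "stores ?s B'" "used ?s = used s1"
      using ready1 B'(1) by (simp_all add: ready_def stores_def used_def)
    then have "walk_inv P c k l i (\<mu> - 1) ?s"
      using B'(2) s(5,6,7) stamps mu(2) pot' regs1
      by (auto simp: walk_inv_def unbalanced_def intro!: exI[of _ B'])
    with mu(1) show "ok (Seq (Assign ''x'' (Const 0)) (Assign ''y'' (Const 0))) (1 + (m * 13 + 4)) s1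
       (\<lambda>s'. \<exists>\<mu>'<\<mu>. walk_inv P c k l i \<mu>' s')"
      by (intro ok_loop_free) auto
  qed
  then have "ok walk_step (4 + ((1 + (m * 13 + 4)) + 1)) s (\<lambda>s'. \<exists>\<mu>'<\<mu>. walk_inv P c k l i \<mu>' s')"
    unfolding walk_step_def by (intro ok_Seq[OF ok_loop_free]) (simp_all add: s1_def)
  then show ?thesis
    by (rule ok_mono) auto
qed


text \<open>\<open>\<mu>\<close> encodes the lexicographic pair of the potential and the number of
  triples left. The latter is at most \<open>n * n * n\<close>, so one unit of potential outweighs
  it.\<close>

definition search_inv :: "nat \<Rightarrow> state \<Rightarrow> bool" where
  "search_inv \<mu> s \<longleftrightarrow>
     ready s \<and> (\<forall>g<m. arrs s ''Z'' g \<le> regs s ''c'') \<and> regs s ''k'' \<le> n \<and>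
     (regs s ''k'' < n \<longrightarrow> regs s ''l'' < n \<and> regs s ''i'' < n) \<and>
     (\<exists>B. stores s B \<and> assignment_table n m B \<and>
       (\<forall>k<n. \<forall>l<n. \<forall>i<n.
          k < regs s ''k'' \<or> k = regs s ''k'' \<and> (l < regs s ''l'' \<or> l = regs s ''l'' \<and> i < regs s ''i'') \<longrightarrow>
          value_count V {..<m} B k i \<le> value_count V {..<m} B l i + 1) \<and>
       \<mu> = potential n m V B * (n * n * n + 1)
         + (n * n * n - (regs s ''k'' * (n * n) + regs s ''l'' * n + regs s ''i'')))"

lemma ok_balance_round:
  assumes inv: "search_inv \<mu> s" and k_less: "regs s ''k'' < n"
  shows "ok balance_round (m * (m * 13 + 11) + m * 13 + 17) s (\<lambda>s'. \<exists>\<mu>'<\<mu>. search_inv \<mu>' s')"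
proof -
  define k l i c where "k = regs s ''k''" and "l = regs s ''l''" and "i = regs s ''i''"
    and "c = regs s ''c'' + 1"
  let ?post = "\<lambda>s'. \<exists>\<mu>'<\<mu>. search_inv \<mu>' s'"
  from inv k_less obtain B where B: "stores s B" "assignment_table n m B"
    and bal: "\<And>k' l' i'. k' < n \<Longrightarrow> l' < n \<Longrightarrow> i' < n \<Longrightarrow>
      k' < k \<or> k' = k \<and> (l' < l \<or> l' = l \<and> i' < i) \<Longrightarrow>
      value_count V {..<m} B k' i' \<le> value_count V {..<m} B l' i' + 1"
    and mu: "\<mu> = potential n m V B * (n * n * n + 1) + (n * n * n - (k * (n * n) + l * n + i))"
    unfolding search_inv_def k_def l_def i_def by blast
  have s: "ready s" "k < n" "l < n" "i < n" "\<forall>g<m. arrs s ''Z'' g < c"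
    using inv k_less by (auto simp: search_inv_def k_def l_def i_def c_def less_Suc_eq_le)
  define s1 where "s1 = exec (Seq (Assign ''j'' (Reg ''i'')) (Assign ''c'' (Add (Reg ''c'') (Const 1)))) s"
  have s1: "ready s1" "stores s1 B" "regs s1 ''k'' = k" "regs s1 ''l'' = l" "regs s1 ''j'' = i"
    "regs s1 ''i'' = i" "regs s1 ''c'' = c" "arrs s1 = arrs s"
    using s(1) B(1) by (auto simp: s1_def ready_def stores_def k_def l_def i_def c_def)
  let ?branch = "IfElse unbalanced (Seq (While unbalanced walk_step) restart) advance"
  have "ok ?branch ((m * (m * 13 + 11) + 10) + 1) s2 ?post"
    if un: "unchanged {''g'', ''x'', ''y'', ''h''} s1 s2"
      and x: "regs s2 ''x'' = value_count V {..<m} B k i"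
      and y: "regs s2 ''y'' = value_count V {..<m} B l i"
      and h: "(\<exists>g<m. arrs s1 ''Z'' g \<noteq> regs s1 ''c'' \<and> B k g = i \<and> V i g) \<longrightarrow>
       regs s2 ''h'' < m \<and> arrs s1 ''Z'' (regs s2 ''h'') \<noteq> regs s1 ''c'' \<and>
       B k (regs s2 ''h'') = i \<and> V i (regs s2 ''h'')" for s2
  proof -
    have s2: "ready s2" "stores s2 B" "regs s2 ''k'' = k" "regs s2 ''l'' = l" "regs s2 ''j'' = i"
      "regs s2 ''i'' = i" "regs s2 ''c'' = c" "arrs s2 = arrs s" "regs s2 ''n'' = n"
      using un s1 ready_unchanged[OF s1(1) un] by (auto simp: unchanged_def stores_def ready_def)
    show ?thesis
    proof (rule ok_IfElse)
      assume unb: "eval_cond unbalanced s2"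
      have used: "used s2 = {}"
        using s(5) s2 by (auto simp: used_def)
      have item: "\<exists>g<m. g \<notin> used s2 \<and> B k g = i \<and> V i g"
        using unb x y unfolding used
        by (intro unused_item_exists[where l = l]) (auto simp: unbalanced_def value_count_def)
      \<comment> \<open>No item is used yet, so the trail is empty with both ends at
        \<open>i\<close>; the slack 4 comes from the imbalance of at least two.\<close>
      have "walk_inv (potential n m V B) c k l i m s2"
        unfolding walk_inv_def s2 used using s s2 B unb x y item h
        by (intro conjI exI[of _ B])
          (auto simp: unbalanced_def used_def value_count_def s1 intro: less_imp_le)
      then have "ok (While unbalanced walk_step) (m * (m * 13 + 10 + 1) + 1) s2
          (\<lambda>s'. \<not> eval_cond unbalanced s' \<and> (\<exists>\<mu>'. walk_inv (potential n m V B) c k l i \<mu>' s'))"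
        by (rule ok_While[rotated]) (rule ok_walk_step)
      then have "ok (Seq (While unbalanced walk_step) restart) ((m * (m * 13 + 10 + 1) + 1) + 3) s2 ?post"
      proof (rule ok_Seq[OF ok_mono[OF _ order_refl]], elim conjE exE)
        fix s' \<mu>' assume "\<not> eval_cond unbalanced s'" "walk_inv (potential n m V B) c k l i \<mu>' s'"
        then obtain B' where s': "ready s'" "\<forall>g<m. arrs s' ''Z'' g \<le> regs s' ''c''"
            "stores s' B'" "assignment_table n m B'" "potential n m V B' < potential n m V B"
          by (auto simp: walk_inv_def)
        let ?\<mu> = "potential n m V B' * (n * n * n + 1) + n * n * n"
        have "search_inv ?\<mu> (exec restart s')"
          using s' by (auto simp: search_inv_def restart_def ready_def stores_def intro!: exI[of _ B'])
        \<comment> \<open>The restart may add up to \<open>n * n * n\<close>, less than the weight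
          of the potential lost.\<close>
        moreover have "?\<mu> < \<mu>"
        proof -
          have "?\<mu> < Suc (potential n m V B') * (n * n * n + 1)"
            by simp
          also have "\<dots> \<le> potential n m V B * (n * n * n + 1)"
            using s'(5) by (intro mult_right_mono) auto
          finally show ?thesis unfolding mu by simp
        qed
        ultimately have "?post (exec restart s')" by blast
        then show "ok restart 3 s' ?post"
          by (intro ok_loop_free) (simp_all add: restart_def)
      qed
      then show "ok (Seq (While unbalanced walk_step) restart) (m * (m * 13 + 11) + 10) s2 ?post"
        by (rule ok_mono) (simp_all add: algebra_simps)
    next
      assume "\<not> eval_cond unbalanced s2"
      then have here: "value_count V {..<m} B k i \<le> value_count V {..<m} B l i + 1"
        using x y by (simp add: unbalanced_def)
      define s3 where "s3 = exec advance s2"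
      have un3: "unchanged {''k'', ''l'', ''i''} s2 s3"
        by (auto simp: s3_def advance_def unchanged_def)
      have pos: "regs s3 ''i'' = (if i + 1 < n then i + 1 else 0)"
        "regs s3 ''l'' = (if i + 1 < n then l else if l + 1 < n then l + 1 else 0)"
        "regs s3 ''k'' = (if i + 1 < n \<or> l + 1 < n then k else k + 1)"
        by (simp_all add: s3_def advance_def s2)
      have last: "n = Suc i" if "\<not> i + 1 < n"
        using that s by simp
      have last': "n = Suc l" if "\<not> l + 1 < n"
        using that s by simp
      \<comment> \<open>Positions are numerals in base \<open>n\<close>, and \<open>advance\<close>
        adds one with carry.\<close>
      have next_idx: "regs s3 ''k'' * (n * n) + regs s3 ''l'' * n + regs s3 ''i''
          = k * (n * n) + l * n + i + 1"
      proof (cases "i + 1 < n")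
        case False
        note i = last[OF this]
        show ?thesis
        proof (cases "l + 1 < n")
          case True
          with i show ?thesis by (simp add: pos)
        next
          case l: False
          with False last'[OF l] i have "i = l" by simp
          with False l i show ?thesis by (simp add: pos)
        qed
      qed (simp add: pos)
      \<comment> \<open>The old position lies below \<open>n * n * n\<close>, so the truncated
        difference really decreases.\<close>
      have "k * (n * n) + l * n + i < n * n * n"
      proof -
        have "(l + 1) * n \<le> n * n" "(k + 1) * (n * n) \<le> n * (n * n)"
          using s by (intro mult_right_mono; simp)+
        with s show ?thesis by (simp add: algebra_simps)
      qed
      then have less: "potential n m V B * (n * n * n + 1)
         + (n * n * n - (regs s3 ''k'' * (n * n) + regs s3 ''l'' * n + regs s3 ''i'')) < \<mu>"
        unfolding mu next_idx by simp
      have bal': "value_count V {..<m} B k' i' \<le> value_count V {..<m} B l' i' + 1"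
        if "k' < n" "l' < n" "i' < n" "k' < regs s3 ''k'' \<or> k' = regs s3 ''k'' \<and>
          (l' < regs s3 ''l'' \<or> l' = regs s3 ''l'' \<and> i' < regs s3 ''i'')" for k' l' i'
      proof -
        have "k' < k \<or> k' = k \<and> (l' < l \<or> l' = l \<and> i' < i) \<or> k' = k \<and> l' = l \<and> i' = i"
          using that last last' by (auto simp: pos less_Suc_eq split: if_splits)
        with bal[OF that(1-3)] here show ?thesis by blast
      qed
      have "ready s3"
        using ready_unchanged[OF s2(1) un3] by simp
      moreover have "arrs s3 = arrs s" "regs s3 ''c'' = c"
        using un3 s2 by (auto simp: unchanged_def)
      moreover have "stores s3 B"
        using B(1) calculation(2) by (simp add: stores_def)
      moreover have "regs s3 ''k'' \<le> n" "regs s3 ''k'' < n \<longrightarrow> regs s3 ''l'' < n \<and> regs s3 ''i'' < n"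
        using s by (auto simp: pos)
      ultimately have "search_inv (potential n m V B * (n * n * n + 1)
         + (n * n * n - (regs s3 ''k'' * (n * n) + regs s3 ''l'' * n + regs s3 ''i''))) s3"
        unfolding search_inv_def using B(2) s(5) bal' by (intro conjI exI[of _ B]) (auto intro: less_imp_le)
      with less have "?post s3" by blast
      then show "ok advance (m * (m * 13 + 11) + 10) s2 ?post"
        unfolding s3_def by (intro ok_loop_free) (simp_all add: advance_def)
    qed
  qed
  then have tail: "ok (Seq scan ?branch) ((m * 13 + 4) + ((m * (m * 13 + 11) + 10) + 1)) s1 ?post"
    using ok_scan[OF s1(1,2,3) s(2) s1(4) s(3) s1(5) s(4)]
    by (intro ok_Seq[OF ok_mono[OF _ order_refl]]) blast+
  have "ok balance_round (2 + ((m * 13 + 4) + ((m * (m * 13 + 11) + 10) + 1))) s ?post"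
    unfolding balance_round_def by (rule ok_Seq[OF ok_loop_free]) (use tail in \<open>simp_all add: s1_def\<close>)
  then show ?thesis
    by (rule ok_mono) auto
qed

text \<open>\<open>potential_le\<close> bounds the initial measure and hence the number of rounds.
  When \<open>k\<close> has reached \<open>n\<close>, every triple has been passed.\<close>

lemma ok_balance:
  assumes s: "ready s" "stores s B" "assignment_table n m B" "\<forall>g<m. arrs s ''Z'' g \<le> regs s ''c''"
  shows "ok balance
     ((n * n * (m * m) * (n * n * n + 1) + n * n * n) * (m * (m * 13 + 11) + m * 13 + 18) + 4) s
     (\<lambda>s'. \<exists>B. ready s' \<and> stores s' B \<and> assignment_table n m B \<and> balanced n m V B)"
proof -
  let ?K = "n * n * (m * m) * (n * n * n + 1) + n * n * n" and ?T = "m * (m * 13 + 11) + m * 13 + 17"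
  let ?\<mu> = "potential n m V B * (n * n * n + 1) + n * n * n"
  have "search_inv ?\<mu> (exec restart s)"
    using s by (auto simp: search_inv_def restart_def ready_def stores_def intro!: exI[of _ B])
  then have "ok (While (Less (Reg ''k'') (Reg ''n'')) balance_round) (?\<mu> * (?T + 1) + 1) (exec restart s)
      (\<lambda>s'. \<not> eval_cond (Less (Reg ''k'') (Reg ''n'')) s' \<and> (\<exists>\<mu>'. search_inv \<mu>' s'))"
  proof (rule ok_While[rotated])
    fix \<mu> s' assume "search_inv \<mu> s'" "eval_cond (Less (Reg ''k'') (Reg ''n'')) s'"
    moreover from this have "regs s' ''k'' < n"
      by (simp add: search_inv_def ready_def)
    ultimately show "ok balance_round ?T s' (\<lambda>s'. \<exists>\<mu>'<\<mu>. search_inv \<mu>' s')"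
      by (intro ok_balance_round)
  qed
  then have "ok balance (3 + (?\<mu> * (?T + 1) + 1)) s
      (\<lambda>s'. \<not> eval_cond (Less (Reg ''k'') (Reg ''n'')) s' \<and> (\<exists>\<mu>'. search_inv \<mu>' s'))"
    unfolding balance_def by (intro ok_Seq[OF ok_loop_free]) (simp_all add: restart_def)
  then show ?thesis
  proof (rule ok_mono)
    have "?\<mu> \<le> ?K"
      using mult_right_mono[OF potential_le, of "n * n * n + 1"] by simp
    then have "?\<mu> * (?T + 1) \<le> ?K * (?T + 1)"
      by (rule mult_right_mono) simp
    moreover have "?T + 1 = m * (m * 13 + 11) + m * 13 + 18"
      by simp
    ultimately have "?\<mu> * (?T + 1) \<le> ?K * (m * (m * 13 + 11) + m * 13 + 18)"
      by (simp only:)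
    moreover have "3 + (a + 1) \<le> b + 4" if "a \<le> b" for a b :: nat
      using that by simp
    ultimately show "3 + (?\<mu> * (?T + 1) + 1) \<le> ?K * (m * (m * 13 + 11) + m * 13 + 18) + 4"
      by blast
  next
    fix s' assume *: "\<not> eval_cond (Less (Reg ''k'') (Reg ''n'')) s' \<and> (\<exists>\<mu>'. search_inv \<mu>' s')"
    then obtain B where B: "stores s' B" "assignment_table n m B" "ready s'" "\<not> regs s' ''k'' < n"
       and "\<forall>k<n. \<forall>l<n. \<forall>i<n. k < regs s' ''k'' \<longrightarrow>
          value_count V {..<m} B k i \<le> value_count V {..<m} B l i + 1"
      by (auto simp: search_inv_def ready_def)
    then have "balanced n m V B"
      by (auto simp: balanced_def)
    with B show "\<exists>B. ready s' \<and> stores s' B \<and> assignment_table n m B \<and> balanced n m V B"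
      by blast
  qed
qed

section \<open>Initial table and output\<close>

lemma ok_fill:
  assumes s: "regs s ''n'' = n" "regs s ''m'' = m" "out s = []"
    "\<forall>i<n. \<forall>g<m. arrs s ''v'' (i * m + g) = of_bool (V i g)"
  shows "ok fill (n * (m * 4 + 5) + 3) s (\<lambda>s'. ready s' \<and> stores s' (\<lambda>k g. k) \<and>
    arrs s' ''Z'' = arrs s ''Z'' \<and> regs s' ''c'' = regs s ''c'')"
proof -
  \<comment> \<open>\<open>p\<close> counts the cells written so far; cell \<open>x\<close> belongs
    to row \<open>x div m\<close>, whose number is the agent stored there.\<close>
  define Inv where "Inv p s' \<longleftrightarrow> regs s' ''n'' = n \<and> regs s' ''m'' = m \<and> out s' = [] \<and>
      arrs s' ''v'' = arrs s ''v'' \<and> arrs s' ''Z'' = arrs s ''Z'' \<and> regs s' ''c'' = regs s ''c'' \<and>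
      regs s' ''a'' = p \<and> (\<forall>x<p. arrs s' ''B'' x = x div m)" for p and s' :: state
  define rows where "rows k s' \<longleftrightarrow> (\<forall>k'<k. arrs s' ''r'' k' = k' * m)" for k and s' :: state
  let ?body = "Seq (Store ''r'' (Reg ''k'') (Reg ''a'')) (For ''g'' (Reg ''m'') fill_row)"
  have "ok (For ''k'' (Reg ''n'') ?body) (n * ((1 + (m * (2 + 2) + 2)) + 2) + 2) (set_reg ''a'' 0 s)
     (\<lambda>s'. Inv (n * m) s' \<and> rows n s')"
  proof (rule ok_For[where Inv = "\<lambda>k s'. Inv (k * m) s' \<and> rows k s'"])
    fix k s' assume k: "k < n" and inv: "Inv (k * m) s' \<and> rows k s'" and kk: "regs s' ''k'' = k"
    let ?s = "exec (Store ''r'' (Reg ''k'') (Reg ''a'')) s'"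
    let ?J = "\<lambda>g s'. Inv (k * m + g) s' \<and> rows (Suc k) s' \<and> regs s' ''k'' = k"
    have "ok (For ''g'' (Reg ''m'') fill_row) (m * (2 + 2) + 2) ?s (?J m)"
    proof (rule ok_For[where Inv = "?J"])
      fix g s' assume g: "g < m" "regs s' ''g'' = g" and inv: "?J g s'"
      have "regs (exec fill_row s') ''g'' = g \<and> ?J (Suc g) (set_reg ''g'' (Suc g) (exec fill_row s'))"
        using g inv by (auto simp: fill_row_def Inv_def rows_def less_Suc_eq)
      moreover have "loop_free fill_row" "cost fill_row \<le> 2"
        by (simp_all add: fill_row_def)
      ultimately show "ok fill_row 2 s' (\<lambda>s'. regs s' ''g'' = g \<and> ?J (Suc g) (set_reg ''g'' (Suc g) s'))"
        by (intro ok_loop_free)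
    qed (use inv kk in \<open>auto simp: Inv_def rows_def less_Suc_eq\<close>)
    then have "ok ?body (1 + (m * (2 + 2) + 2)) s' (?J m)"
      by (intro ok_Seq[OF ok_loop_free]) simp_all
    then show "ok ?body (1 + (m * (2 + 2) + 2)) s' (\<lambda>s'. regs s' ''k'' = k \<and>
        Inv (Suc k * m) (set_reg ''k'' (Suc k) s') \<and> rows (Suc k) (set_reg ''k'' (Suc k) s'))"
      by (rule ok_mono) (auto simp: Inv_def rows_def add.commute)
  qed (use s in \<open>auto simp: Inv_def rows_def\<close>)
  then have "ok fill (1 + (n * ((1 + (m * (2 + 2) + 2)) + 2) + 2)) s (\<lambda>s'. Inv (n * m) s' \<and> rows n s')"
    unfolding fill_def by (intro ok_Seq[OF ok_loop_free]) simp_all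
  then show ?thesis
  proof (rule ok_mono)
    fix s' assume inv: "Inv (n * m) s' \<and> rows n s'"
    have "k * m + g < n * m" if "k < n" "g < m" for k g
    proof -
      have "k * m + g < (k + 1) * m" using that by simp
      also have "\<dots> \<le> n * m" using that by (intro mult_right_mono) auto
      finally show ?thesis .
    qed
    with inv have "stores s' (\<lambda>k g. k)"
      by (auto simp: Inv_def stores_def)
    with inv s show "ready s' \<and> stores s' (\<lambda>k g. k) \<and>
        arrs s' ''Z'' = arrs s ''Z'' \<and> regs s' ''c'' = regs s ''c''"
      by (auto simp: Inv_def rows_def ready_def)
  qed (simp add: algebra_simps)
qed

definition lottery :: "(nat \<Rightarrow> nat \<Rightarrow> nat) \<Rightarrow> (nat \<times> nat \<times> (nat \<Rightarrow> nat set)) list" where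
  "lottery B = map (\<lambda>k. (1, n, bundles n m Suc B k)) [0..<n]"

lemma ok_write_table:
  assumes s: "ready s" "stores s B"
  shows "ok write_table (n * (n * (m * 3 + 4) + 6) + 2) s
    (\<lambda>s'. out s' = encode_output n m (lottery B))"
proof -
  let ?Q = "\<lambda>k i g. g \<in> bundles n m Suc B k i"
  let ?keep = "\<lambda>s' :: state. arrs s' = arrs s \<and> regs s' ''n'' = n \<and> regs s' ''m'' = m"
  let ?block = "\<lambda>k. 1 # n # table n m (?Q k)"
  let ?body = "Seq (Seq (Write (Const 1)) (Write (Reg ''n'')))
     (For ''i'' (Reg ''n'') (For ''g'' (Reg ''m'') write_cell))"
  have "ok write_table (n * ((2 + (n * ((m * (1 + 2) + 2) + 2) + 2)) + 2) + 2) s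
     (\<lambda>s'. ?keep s' \<and> out s' = concat (map ?block [0..<n]))"
    unfolding write_table_def
  proof (rule ok_For[where Inv = "\<lambda>k s'. ?keep s' \<and> out s' = concat (map ?block [0..<k])"])
    fix k s1 assume k: "k < n" "regs s1 ''k'' = k"
      and s1: "?keep s1 \<and> out s1 = concat (map ?block [0..<k])"
    let ?s1 = "exec (Seq (Write (Const 1)) (Write (Reg ''n''))) s1"
    \<comment> \<open>\<open>table i m\<close> consists of the first \<open>i\<close> rows, so it
      describes the partly written block.\<close>
    let ?J = "\<lambda>i s'. ?keep s' \<and> regs s' ''k'' = k \<and>
      out s' = concat (map ?block [0..<k]) @ 1 # n # table i m (?Q k)"
    have "ok (For ''i'' (Reg ''n'') (For ''g'' (Reg ''m'') write_cell))
       (n * ((m * (1 + 2) + 2) + 2) + 2) ?s1 (?J n)"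
    proof (rule ok_For[where Inv = "?J"])
      fix i s2 assume i: "i < n" "regs s2 ''i'' = i" and s2: "?J i s2"
      let ?I = "\<lambda>g s'. ?keep s' \<and> regs s' ''k'' = k \<and> regs s' ''i'' = i \<and>
        out s' = out s2 @ map (\<lambda>g. of_bool (?Q k (Suc i) g)) [1..<g+1]"
      have "ok (For ''g'' (Reg ''m'') write_cell) (m * (1 + 2) + 2) s2 (?I m)"
      proof (rule ok_For[where Inv = "?I"])
        fix g s3 assume g: "g < m" "regs s3 ''g'' = g" and s3: "?I g s3"
        \<comment> \<open>Registers count from 0, agents and items in the output from 1.\<close>
        have "?Q k (Suc i) (Suc g) \<longleftrightarrow> B k g = i"
          using i g by (auto simp: bundles_def)
        then have "regs (exec write_cell s3) ''g'' = g \<and> ?I (Suc g) (set_reg ''g'' (Suc g) (exec write_cell s3))"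
          using g s3 i k s by (auto simp: write_cell_def ready_def stores_def)
        moreover have "loop_free write_cell" "cost write_cell \<le> 1"
          by (simp_all add: write_cell_def)
        ultimately show "ok write_cell 1 s3
            (\<lambda>s'. regs s' ''g'' = g \<and> ?I (Suc g) (set_reg ''g'' (Suc g) s'))"
          by (intro ok_loop_free)
      qed (use s2 i in auto)
      then show "ok (For ''g'' (Reg ''m'') write_cell) (m * (1 + 2) + 2) s2
          (\<lambda>s'. regs s' ''i'' = i \<and> ?J (Suc i) (set_reg ''i'' (Suc i) s'))"
        by (rule ok_mono) (use s2 in \<open>auto simp: table_def\<close>)
    qed (use s1 k in \<open>auto simp: table_def\<close>)
    then have "ok ?body (2 + (n * ((m * (1 + 2) + 2) + 2) + 2)) s1 (?J n)"
      by (intro ok_Seq[OF ok_loop_free]) simp_all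
    then show "ok ?body (2 + (n * ((m * (1 + 2) + 2) + 2) + 2)) s1 (\<lambda>s'. regs s' ''k'' = k \<and>
        ?keep (set_reg ''k'' (Suc k) s') \<and>
        out (set_reg ''k'' (Suc k) s') = concat (map ?block [0..<Suc k]))"
      by (rule ok_mono) auto
  qed (use s in \<open>auto simp: ready_def\<close>)
  then show ?thesis
    by (rule ok_mono) (auto simp: encode_output_def lottery_def comp_def algebra_simps)
qed

end

text \<open>Over a general semiring the same formula serves as a number of steps and, at
  \<open>[:0, 1:]\<close>, as a polynomial.\<close>

definition program_time :: "'a :: comm_semiring_1 \<Rightarrow> 'a \<Rightarrow> 'a" where
  "program_time n m = n * (m * 4 + 5) + 3
     + ((n * n * (m * m) * (n * n * n + 1) + n * n * n) * (m * (m * 13 + 11) + m * 13 + 18) + 4)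
     + (n * (n * (m * 3 + 4) + 6) + 2) + 1"

lemma ok_program:
  assumes "0 < m" and s: "regs s ''n'' = n" "regs s ''m'' = m" "out s = []" "arrs s ''Z'' = (\<lambda>_. 0)"
    "\<forall>i<n. \<forall>g<m. arrs s ''v'' (i * m + g) = of_bool (V i g)"
  shows "ok program (program_time n m) s (\<lambda>s'. \<exists>B. assignment_table n m B \<and> balanced n m V B \<and>
    out s' = encode_output n m (lottery n m B))"
proof -
  let ?post = "\<lambda>s'. \<exists>B. assignment_table n m B \<and> balanced n m V B \<and>
    out s' = encode_output n m (lottery n m B)"
  have ident: "assignment_table n m (\<lambda>k g. k)"
    by (simp add: assignment_table_def bij_betw_def)
  have write_out: "ok write_table (n * (n * (m * 3 + 4) + 6) + 2) s' ?post"
    if "ready n m V s'" "stores n m s' B" "assignment_table n m B" "balanced n m V B" for s' B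
    using ok_write_table[OF that(1,2)] by (rule ok_mono) (use that in auto)
  have "ok (Seq balance write_table)
      (((n * n * (m * m) * (n * n * n + 1) + n * n * n) * (m * (m * 13 + 11) + m * 13 + 18) + 4)
       + (n * (n * (m * 3 + 4) + 6) + 2)) s' ?post"
    if "ready n m V s'" "stores n m s' (\<lambda>k g. k)" "arrs s' ''Z'' = (\<lambda>_. 0)" for s'
    by (rule ok_Seq[OF ok_mono[OF ok_balance[OF that(1,2) ident] order_refl]])
      (use that write_out in auto)
  then have "ok (Seq fill (Seq balance write_table)) ((n * (m * 4 + 5) + 3)
      + (((n * n * (m * m) * (n * n * n + 1) + n * n * n) * (m * (m * 13 + 11) + m * 13 + 18) + 4)
       + (n * (n * (m * 3 + 4) + 6) + 2))) s ?post"
    by (intro ok_Seq[OF ok_mono[OF ok_fill[OF s(1-3,5)] order_refl]]) (use s in auto)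
  then have "ok program (((n * (m * 4 + 5) + 3)
      + (((n * n * (m * m) * (n * n * n + 1) + n * n * n) * (m * (m * 13 + 11) + m * 13 + 18) + 4)
       + (n * (n * (m * 3 + 4) + 6) + 2))) + 1) s ?post"
    unfolding program_def by (intro ok_IfElse) (use assms in auto)
  then show ?thesis
    by (rule ok_mono) (simp_all add: program_time_def)
qed

lemma program_time_mono:
  fixes n m N :: nat
  assumes "n \<le> N" "m \<le> N"
  shows "program_time n m \<le> program_time N N"
  unfolding program_time_def by (intro add_mono mult_mono assms order_refl) auto

lemma poly_program_time: "poly (program_time p q) x = program_time (poly p x) (poly q x)"
  by (simp add: program_time_def)

section \<open>Existence and polynomial-time computation\<close>

lemma balanced_table_exists:
  assumes "0 < m"
  shows "\<exists>B. assignment_table n m B \<and> balanced n m V B"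
proof -
  \<comment> \<open>Existence is read off the program: started on an encoding of \<open>V\<close>,
    it halts with a balanced table.\<close>
  define s where "s = \<lparr>regs = (\<lambda>_. 0)(''n'' := n, ''m'' := m),
    arrs = (\<lambda>_ _. 0)(''v'' := (\<lambda>x. of_bool (V (x div m) (x mod m)))), out = []\<rparr>"
  have "ok program (program_time n m) s (\<lambda>s'. \<exists>B. assignment_table n m B \<and> balanced n m V B \<and>
    out s' = encode_output n m (lottery n m B))"
    using assms by (intro ok_program) (auto simp: s_def)
  then show ?thesis
    by (auto simp: ok_def)
qed

lemma nth_table:
  assumes "i < n" "g < m"
  shows "i * m + g < length (table n m Q)" and "table n m Q ! (i * m + g) = of_bool (Q (Suc i) (Suc g))"
proof -
  have "length (table k m Q) = k * m" for k
    by (induction k) (auto simp: table_def)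
  note len = this
  have "i * m + g < n * m \<and> table n m Q ! (i * m + g) = of_bool (Q (Suc i) (Suc g))"
    using assms(1)
  proof (induction n)
    case (Suc n)
    have split: "table (Suc n) m Q = table n m Q @ map (\<lambda>g. of_bool (Q (Suc n) g)) [1..<m+1]"
      by (simp add: table_def)
    show ?case
    proof (cases "i = n")
      case True
      have "map (\<lambda>g. of_bool (Q (Suc n) g)) [1..<m+1] ! g = of_bool (Q (Suc n) (Suc g))"
        using assms(2) by (subst nth_map) (auto simp del: upt_Suc)
      then show ?thesis
        using True assms(2) unfolding split by (auto simp: nth_append len simp del: upt_Suc)
    next
      case False
      with Suc show ?thesis
        unfolding split by (auto simp: nth_append len simp del: upt_Suc)
    qed
  qed simp
  then show "i * m + g < length (table n m Q)" "table n m Q ! (i * m + g) = of_bool (Q (Suc i) (Suc g))"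
    by (auto simp: len)
qed

text \<open>Items of any type are numbered by a bijection \<open>e\<close>, which reduces the claim
  to tables.\<close>

lemma EF_EQ_EQ1_exists:
  assumes "normalized_binary_goods_instance n M v"
  shows "\<exists>R. EF_EQ_EQ1_randomized_allocation n M v R"
proof (cases "M = {}")
  case True
  with assms EF_EQ_EQ1_no_items show ?thesis by blast
next
  case False
  have "finite M"
    using assms by (auto simp: normalized_binary_goods_instance_def additive_instance_def)
  then obtain e where e: "bij_betw e {..<card M} M"
    using ex_bij_betw_nat_finite[of M] by (auto simp: atLeast0LessThan)
  have m: "0 < card M"
    using False \<open>finite M\<close> by (simp add: card_gt_0_iff)
  obtain B where "assignment_table n (card M) B"
    "balanced n (card M) (\<lambda>i g. v (Suc i) {e g} = 1) B"
    using balanced_table_exists[OF m] by blast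
  from EF_EQ_EQ1_bundles[OF assms e m this(1) _ this(2)] show ?thesis by blast
qed

lemma program_correct:
  fixes v :: "nat \<Rightarrow> nat set \<Rightarrow> real"
  assumes inst: "normalized_binary_goods_instance n {1..m} v"
  shows "\<exists>t s L. runs program (input_state n m v) t s \<and> t \<le> poly (program_time [:0, 1:] [:0, 1:]) (n + m) \<and>
         out s = encode_output n m L \<and> (\<forall>(a, b, A)\<in>set L. a > 0 \<and> b > 0) \<and>
         EF_EQ_EQ1_randomized_allocation n {1..m} v (to_randomized L)"
proof -
  let ?good = "\<lambda>L. (\<forall>(a, b, A)\<in>set L. a > 0 \<and> b > 0) \<and>
         EF_EQ_EQ1_randomized_allocation n {1..m} v (to_randomized L)"
  let ?s = "input_state n m v"
  have s: "regs ?s ''n'' = n" "regs ?s ''m'' = m" "out ?s = []" "arrs ?s ''Z'' = (\<lambda>_. 0)"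
    by (simp_all add: input_state_def Let_def)
  have "ok program (program_time n m) ?s (\<lambda>s'. \<exists>L. out s' = encode_output n m L \<and> ?good L)"
  proof (cases "m = 0")
    case True
    have "EF_EQ_EQ1_randomized_allocation n {1..m} v (to_randomized [(1, 1, \<lambda>_. {})])"
      using EF_EQ_EQ1_no_items[of n v] inst True by (simp add: to_randomized_def)
    moreover have "table n 0 Q = []" for Q
      by (simp add: table_def)
    ultimately have "\<exists>L. [1, 1] = encode_output n m L \<and> ?good L"
      using True by (intro exI[of _ "[(1, 1, \<lambda>_. {})]"]) (simp add: encode_output_def)
    then have "ok program (2 + 1) ?s (\<lambda>s'. \<exists>L. out s' = encode_output n m L \<and> ?good L)"
      unfolding program_def using True s by (intro ok_IfElse ok_loop_free) simp_all
    then show ?thesis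
      by (rule ok_mono) (simp_all add: program_time_def)
  next
    case False
    let ?V = "\<lambda>i g. v (Suc i) {Suc g} = 1"
    have "\<forall>i<n. \<forall>g<m. arrs ?s ''v'' (i * m + g) = of_bool (?V i g)"
      by (auto simp: input_state_def Let_def nth_table)
    with False s have "ok program (program_time n m) ?s (\<lambda>s'. \<exists>B. assignment_table n m B \<and>
        balanced n m ?V B \<and> out s' = encode_output n m (lottery n m B))"
      by (intro ok_program) auto
    then show ?thesis
    proof (rule ok_mono[OF _ order_refl], elim exE conjE)
      fix s' B assume B: "assignment_table n m B" "balanced n m ?V B"
        and "out s' = encode_output n m (lottery n m B)"
      moreover have "bij_betw Suc {..<m} {1..m}"
        by (auto simp: bij_betw_def image_Suc_lessThan)
      then have "EF_EQ_EQ1_randomized_allocation n {1..m} v (to_randomized (lottery n m B))"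
        using EF_EQ_EQ1_bundles[OF inst _ _ B(1) _ B(2), of Suc] False
        by (simp add: to_randomized_def lottery_def comp_def)
      moreover have "0 < n"
        using inst by (simp add: normalized_binary_goods_instance_def additive_instance_def)
      ultimately show "\<exists>L. out s' = encode_output n m L \<and> ?good L"
        by (intro exI[of _ "lottery n m B"]) (auto simp: lottery_def)
    qed
  qed
  \<comment> \<open>Both sizes are at most \<open>n + m\<close>, and evaluating the polynomial
    commutes with the formula.\<close>
  moreover have "program_time n m \<le> poly (program_time [:0, 1:] [:0, 1:]) (n + m)"
    using program_time_mono[of n "n + m" m] by (simp add: poly_program_time)
  ultimately show ?thesis
    unfolding ok_def by (meson order_trans)
qed

theorem theorem8:
  "(\<forall>n M (v :: nat \<Rightarrow> 'a set \<Rightarrow> real). normalized_binary_goods_instance n M v \<longrightarrow>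
      (\<exists>R. EF_EQ_EQ1_randomized_allocation n M v R)) \<and>
   (\<exists>(P :: com) (q :: nat poly). \<forall>n m (v :: nat \<Rightarrow> nat set \<Rightarrow> real).
      normalized_binary_goods_instance n {1..m} v \<longrightarrow>
      (\<exists>t s L. runs P (input_state n m v) t s \<and> t \<le> poly q (n + m) \<and>
         out s = encode_output n m L \<and> (\<forall>(a, b, A)\<in>set L. a > 0 \<and> b > 0) \<and>
         EF_EQ_EQ1_randomized_allocation n {1..m} v (to_randomized L)))"
  using EF_EQ_EQ1_exists program_correct by blast

end
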